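(* Call an unordered pair of graphs $\{H_1,H_2\}$ settled if, for some ordering $(H_1,H_2)$ of the pair, one of the following holds: (a1) $H_1\subseteq_i P_4$ or $H_2\subseteq_i P_4$; (a2) $H_1=sP_1$ and $H_2=K_t$ for some positive integers $s,t$; (a3) $H_1\subseteq_i P_1+P_3$ and $\overline{H_2}\subseteq_i K_{1,3}+3P_1$, $K_{1,3}+P_2$, $P_1+S_{1,1,2}$, $P_6$ or $S_{1,1,3}$; (a4) $H_1\subseteq_i 2P_1+P_2$ and $\overline{H_2}\subseteq_i 2P_1+P_3$, $3P_1+P_2$ or $P_2+P_3$; (a5) $H_1\subseteq_i P_1+P_4$ and $\overline{H_2}\subseteq_i P_1+P_4$ or $P_5$; (a6) $H_1\subseteq_i 4P_1$ and $\overline{H_2}\subseteq_i 2P_1+P_3$; (a7) $H_1\subseteq_i K_{1,3}$ and $\overline{H_2}\subseteq_i K_{1,3}$; (b1) $H_1\notin\mathcal{S}$ and $H_2\notin\mathcal{S}$; (b2) $\overline{H_1}\notin\mathcal{S}$ and $\overline{H_2}\notin\mathcal{S}$; (b3) $H_1\supseteq_i K_{1,3}$ or $H_1\supseteq_i 2P_2$, and $\overline{H_2}\supseteq_i 4P_1$ or $\overline{H_2}\supseteq_i 2P_2$; (b4) $H_1\supseteq_i P_1+P_4$ and $\overline{H_2}\supseteq_i P_2+P_4$; (b5) $H_1\supseteq_i 2P_1+P_2$ and $\overline{H_2}\supseteq_i K_{1,3}$, $5P_1$, $P_2+P_4$ or $P_6$; (b6) $H_1\supseteq_i 3P_1$ and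 $\overline{H_2}\supseteq_i 2P_1+2P_2$, $2P_1+P_4$, $4P_1+P_2$, $3P_2$ or $2P_3$; (b7) $H_1\supseteq_i 4P_1$ and $\overline{H_2}\supseteq_i P_1+P_4$ or $3P_1+P_2$. Let $\mathcal{G}$ be a class of graphs defined by two forbidden induced subgraphs. Then $\mathcal{G}$ is not equivalent to the class of $(H_1,H_2)$-free graphs for any settled pair $\{H_1,H_2\}$ if and only if $\mathcal{G}$ is equivalent to the class of $(H_1,H_2)$-free graphs for one of the following 13 pairs: (1) $H_1=3P_1$ and $\overline{H_2}\in\{P_1+P_2+P_3,\ P_1+2P_2,\ P_1+P_5,\ P_1+S_{1,1,3},\ P_2+P_4,\ S_{1,2,2},\ S_{1,2,3}\}$; (2) $H_1=2P_1+P_2$ and $\overline{H_2}\in\{P_1+P_2+P_3,\ P_1+2P_2,\ P_1+P_5\}$; (3) $H_1=P_1+P_4$ and $\overline{H_2}\in\{P_1+2P_2,\ P_2+P_3\}$; (4) $H_1=\overline{H_2}=2P_1+P_3$.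
   Context: All graphs are finite, simple and undirected. $H\subseteq_i G$ (equivalently $G\supseteq_i H$) means $H$ is isomorphic to an induced subgraph of $G$; "$H\subseteq_i A$, $B$ or $C$" means $H$ is an induced subgraph of at least one of $A,B,C$, and similarly for $\supseteq_i$. A graph is $(H_1,H_2)$-free if it has no induced subgraph isomorphic to $H_1$ or $H_2$. $P_r$, $K_r$ denote the path and complete graph on $r$ vertices, $K_{1,3}$ is the claw; $G+H$ is disjoint union, $sG$ is the disjoint union of $s$ copies of $G$, $\overline{G}$ is the complement. For $1\le i\le j\le k$, $S_{i,j,k}$ is the tree with exactly one vertex $x$ of degree $3$ and exactly three leaves, at distances $i,j,k$ from $x$. $\mathcal{S}$ is the class of graphs each of whose connected components is either a path or some $S_{i,j,k}$. Two classes, of $(H_1,H_2)$-free graphs and of $(H_3,H_4)$-free graphs, are equivalent if the unordered pair $\{H_3,H_4\}$ can be obtained from the unordered pair $\{H_1,H_2\}$ by a sequence of the operations: (a) replacing both graphs by their complements; (b) if one graph of the pair is $K_3$, replacing it by $\overline{P_1+P_3}$, or vice versa. *)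

theory Defs
  imports Main
begin

text \<open>
  Vertices are natural numbers. Every finite graph is isomorphic to one of these, and all notions
  below are invariant under isomorphism, so a class of graphs is a \<^typ>\<open>(nat set \<times> nat set set) set\<close>.
\<close>

type_synonym ugraph = "nat set \<times> nat set set"

abbreviation verts :: "ugraph \<Rightarrow> nat set" where "verts \<equiv> fst"
abbreviation edges :: "ugraph \<Rightarrow> nat set set" where "edges \<equiv> snd"

definition fin_graph :: "ugraph \<Rightarrow> bool" where
  "fin_graph G \<longleftrightarrow> finite (verts G) \<and> edges G \<subseteq> {e. e \<subseteq> verts G \<and> card e = 2}"

definition graph_iso :: "ugraph \<Rightarrow> ugraph \<Rightarrow> bool" (infix "\<simeq>" 50) where
  "G \<simeq> H \<longleftrightarrow> (\<exists>f. bij_betw f (verts G) (verts H) \<and>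
     (\<forall>u\<in>verts G. \<forall>v\<in>verts G. {u, v} \<in> edges G \<longleftrightarrow> {f u, f v} \<in> edges H))"

definition induced :: "ugraph \<Rightarrow> nat set \<Rightarrow> ugraph" where
  "induced G W = (W, {e \<in> edges G. e \<subseteq> W})"

definition induced_sub :: "ugraph \<Rightarrow> ugraph \<Rightarrow> bool" (infix "\<subseteq>\<^sub>i" 50) where
  "H \<subseteq>\<^sub>i G \<longleftrightarrow> (\<exists>W\<subseteq>verts G. H \<simeq> induced G W)"

abbreviation induced_super :: "ugraph \<Rightarrow> ugraph \<Rightarrow> bool" (infix "\<supseteq>\<^sub>i" 50) where
  "G \<supseteq>\<^sub>i H \<equiv> H \<subseteq>\<^sub>i G"

definition co :: "ugraph \<Rightarrow> ugraph" where
  "co G = (verts G, {e. e \<subseteq> verts G \<and> card e = 2} - edges G)"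

text \<open>The disjoint union puts the first graph on the even and the second on the odd numbers.\<close>

definition disj_union :: "ugraph \<Rightarrow> ugraph \<Rightarrow> ugraph" (infixl "\<oplus>" 65) where
  "G \<oplus> H = ((\<lambda>n. 2 * n) ` verts G \<union> (\<lambda>n. 2 * n + 1) ` verts H,
            (\<lambda>e. (\<lambda>n. 2 * n) ` e) ` edges G \<union> (\<lambda>e. (\<lambda>n. 2 * n + 1) ` e) ` edges H)"

primrec copies :: "nat \<Rightarrow> ugraph \<Rightarrow> ugraph" (infixr "\<cdot>" 75) where
  "0 \<cdot> G = ({}, {})"
| "Suc s \<cdot> G = G \<oplus> s \<cdot> G"

definition Path :: "nat \<Rightarrow> ugraph" where
  "Path r = ({..<r}, {{m, Suc m} | m. Suc m < r})"

definition Complete :: "nat \<Rightarrow> ugraph" where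
  "Complete r = ({..<r}, {e. e \<subseteq> {..<r} \<and> card e = 2})"

definition Claw :: ugraph where
  "Claw = ({..<4}, {{0, 1}, {0, 2}, {0, 3}})"

text \<open>
  \<open>S_tree i j k\<close> is the tree $S_{i,j,k}$, used only for $1 \le i \le j \le k$. The vertex of
  degree 3 is \<open>0\<close>; the three paths leaving it run through \<open>1, \<dots>, i\<close>, through
  \<open>i + 1, \<dots>, i + j\<close> and through \<open>i + j + 1, \<dots>, i + j + k\<close>. Consecutive numbers are adjacent
  unless the smaller one is the leaf \<open>i\<close> or the leaf \<open>i + j\<close>.
\<close>

definition S_tree :: "nat \<Rightarrow> nat \<Rightarrow> nat \<Rightarrow> ugraph" where
  "S_tree i j k = ({..i + j + k},
     {{m, Suc m} | m. Suc m \<le> i + j + k \<and> m \<noteq> i \<and> m \<noteq> i + j} \<union> {{0, i + 1}, {0, i + j + 1}})"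

definition component :: "ugraph \<Rightarrow> nat \<Rightarrow> nat set" where
  "component G v = {w \<in> verts G. (\<lambda>x y. {x, y} \<in> edges G)\<^sup>*\<^sup>* v w}"

definition class_S :: "ugraph set" where
  "class_S = {G. fin_graph G \<and> (\<forall>v\<in>verts G.
     (\<exists>r\<ge>1. induced G (component G v) \<simeq> Path r) \<or>
     (\<exists>i j k. 1 \<le> i \<and> i \<le> j \<and> j \<le> k \<and> induced G (component G v) \<simeq> S_tree i j k))}"

definition Free :: "ugraph \<Rightarrow> ugraph \<Rightarrow> ugraph set" where
  "Free H1 H2 = {G. fin_graph G \<and> \<not> H1 \<subseteq>\<^sub>i G \<and> \<not> H2 \<subseteq>\<^sub>i G}"

text \<open>
  Unordered pairs of graphs up to isomorphism are represented by ordered pairs; the rules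
  \<open>swap\<close> and \<open>iso\<close> identify the representatives of the same unordered pair.
\<close>

inductive pair_step :: "ugraph \<times> ugraph \<Rightarrow> ugraph \<times> ugraph \<Rightarrow> bool" where
  swap: "pair_step (A, B) (B, A)"
| iso: "fin_graph A' \<Longrightarrow> fin_graph B' \<Longrightarrow> A \<simeq> A' \<Longrightarrow> B \<simeq> B' \<Longrightarrow> pair_step (A, B) (A', B')"
| complement: "pair_step (A, B) (co A, co B)"
| from_K3: "pair_step (Complete 3, B) (co (Path 1 \<oplus> Path 3), B)"
| to_K3: "pair_step (co (Path 1 \<oplus> Path 3), B) (Complete 3, B)"

definition class_equiv :: "ugraph set \<Rightarrow> ugraph set \<Rightarrow> bool" where
  "class_equiv \<G> \<H> \<longleftrightarrow> (\<exists>H1 H2 H3 H4.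
     fin_graph H1 \<and> fin_graph H2 \<and> fin_graph H3 \<and> fin_graph H4 \<and>
     \<G> = Free H1 H2 \<and> \<H> = Free H3 H4 \<and> pair_step\<^sup>*\<^sup>* (H1, H2) (H3, H4))"

definition settled_ordered :: "ugraph \<Rightarrow> ugraph \<Rightarrow> bool" where
  "settled_ordered H1 H2 \<longleftrightarrow>
    (H1 \<subseteq>\<^sub>i Path 4 \<or> H2 \<subseteq>\<^sub>i Path 4)
  \<or> (\<exists>s t. s \<ge> 1 \<and> t \<ge> 1 \<and> H1 \<simeq> s \<cdot> Path 1 \<and> H2 \<simeq> Complete t)
  \<or> (H1 \<subseteq>\<^sub>i Path 1 \<oplus> Path 3 \<and>
      (\<exists>X \<in> {Claw \<oplus> 3 \<cdot> Path 1, Claw \<oplus> Path 2, Path 1 \<oplus> S_tree 1 1 2, Path 6, S_tree 1 1 3}.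
         co H2 \<subseteq>\<^sub>i X))
  \<or> (H1 \<subseteq>\<^sub>i 2 \<cdot> Path 1 \<oplus> Path 2 \<and>
      (\<exists>X \<in> {2 \<cdot> Path 1 \<oplus> Path 3, 3 \<cdot> Path 1 \<oplus> Path 2, Path 2 \<oplus> Path 3}. co H2 \<subseteq>\<^sub>i X))
  \<or> (H1 \<subseteq>\<^sub>i Path 1 \<oplus> Path 4 \<and> (\<exists>X \<in> {Path 1 \<oplus> Path 4, Path 5}. co H2 \<subseteq>\<^sub>i X))
  \<or> (H1 \<subseteq>\<^sub>i 4 \<cdot> Path 1 \<and> co H2 \<subseteq>\<^sub>i 2 \<cdot> Path 1 \<oplus> Path 3)
  \<or> (H1 \<subseteq>\<^sub>i Claw \<and> co H2 \<subseteq>\<^sub>i Claw)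
  \<or> (H1 \<notin> class_S \<and> H2 \<notin> class_S)
  \<or> (co H1 \<notin> class_S \<and> co H2 \<notin> class_S)
  \<or> ((H1 \<supseteq>\<^sub>i Claw \<or> H1 \<supseteq>\<^sub>i 2 \<cdot> Path 2) \<and> (co H2 \<supseteq>\<^sub>i 4 \<cdot> Path 1 \<or> co H2 \<supseteq>\<^sub>i 2 \<cdot> Path 2))
  \<or> (H1 \<supseteq>\<^sub>i Path 1 \<oplus> Path 4 \<and> co H2 \<supseteq>\<^sub>i Path 2 \<oplus> Path 4)
  \<or> (H1 \<supseteq>\<^sub>i 2 \<cdot> Path 1 \<oplus> Path 2 \<and>
      (\<exists>X \<in> {Claw, 5 \<cdot> Path 1, Path 2 \<oplus> Path 4, Path 6}. co H2 \<supseteq>\<^sub>i X))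
  \<or> (H1 \<supseteq>\<^sub>i 3 \<cdot> Path 1 \<and>
      (\<exists>X \<in> {2 \<cdot> Path 1 \<oplus> 2 \<cdot> Path 2, 2 \<cdot> Path 1 \<oplus> Path 4, 4 \<cdot> Path 1 \<oplus> Path 2,
             3 \<cdot> Path 2, 2 \<cdot> Path 3}. co H2 \<supseteq>\<^sub>i X))
  \<or> (H1 \<supseteq>\<^sub>i 4 \<cdot> Path 1 \<and> (\<exists>X \<in> {Path 1 \<oplus> Path 4, 3 \<cdot> Path 1 \<oplus> Path 2}. co H2 \<supseteq>\<^sub>i X))"

definition settled :: "ugraph \<Rightarrow> ugraph \<Rightarrow> bool" where
  "settled H1 H2 \<longleftrightarrow> settled_ordered H1 H2 \<or> settled_ordered H2 H1"

definition listed :: "ugraph \<Rightarrow> ugraph \<Rightarrow> bool" where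
  "listed H1 H2 \<longleftrightarrow>
    (H1 \<simeq> 3 \<cdot> Path 1 \<and>
      (\<exists>X \<in> {Path 1 \<oplus> Path 2 \<oplus> Path 3, Path 1 \<oplus> 2 \<cdot> Path 2, Path 1 \<oplus> Path 5,
             Path 1 \<oplus> S_tree 1 1 3, Path 2 \<oplus> Path 4, S_tree 1 2 2, S_tree 1 2 3}. co H2 \<simeq> X))
  \<or> (H1 \<simeq> 2 \<cdot> Path 1 \<oplus> Path 2 \<and>
      (\<exists>X \<in> {Path 1 \<oplus> Path 2 \<oplus> Path 3, Path 1 \<oplus> 2 \<cdot> Path 2, Path 1 \<oplus> Path 5}. co H2 \<simeq> X))
  \<or> (H1 \<simeq> Path 1 \<oplus> Path 4 \<and>
      (\<exists>X \<in> {Path 1 \<oplus> 2 \<cdot> Path 2, Path 2 \<oplus> Path 3}. co H2 \<simeq> X))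
  \<or> (H1 \<simeq> 2 \<cdot> Path 1 \<oplus> Path 3 \<and> co H2 \<simeq> 2 \<cdot> Path 1 \<oplus> Path 3)"

end

theory Submission
  imports Defs
begin

text \<open>
  Up to swapping, a pair \<open>(H\<^sub>1, H\<^sub>2)\<close> that is not settled has \<open>A = H\<^sub>1\<close> and \<open>B = co H\<^sub>2\<close> in
  \<open>\<S>\<close>: otherwise (b1) or (b2) applies, or a graph and its complement are both forests, which
  forces an induced subgraph of \<open>P\<^sub>4\<close>. Rules (b3) and (b6) then make both \<open>A\<close> and \<open>B\<close> free of the
  five graphs of (b6). Growing forests one leaf at a time shows that a graph of \<open>\<S>\<close> free of these
  five is edgeless or one of finitely many graphs with at most seven vertices, and the remaining
  pairs \<open>(A, B)\<close>, with \<open>P\<^sub>1 + P\<^sub>3\<close> replaced by \<open>3P\<^sub>1\<close>, are compared with the rules by computation.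

  Conversely, the pairs equivalent to a listed one form a short list closed under all operations.
  In each of them the two graphs are incomparable, since \<open>A\<close> and \<open>B\<close> are forests containing
  \<open>3P\<^sub>1\<close>; hence the pair is determined by its class, and no pair of the list is settled.
\<close>

section \<open>Isomorphism, induced subgraphs and complements\<close>

text \<open>The rules treat \<open>H1\<close> and \<open>co H2\<close> asymmetrically, whereas
  equivalence does not: complementing both graphs and exchanging them turns (A, B) into (B, A). In
  these coordinates, trading K3 for the complement of P1+P3 means trading 3P1 for P1+P3 in one of
  the two places. So every rule may be tried in both orders, and one of these two graphs can always
  be traded away.

  Two obstacles shape the rest. The edgeless graphs sP1 meet no obstruction, so the classification
  is a finite table with an infinite tail; as the relevant rules ask only for containment, 5P1
  speaks for the whole tail. Moreover, equivalence is a relation between classes, and a chain of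
  operations may start from any pair that defines the class, not only from the one at hand.\<close>

lemma fin_graph_edgeD:
  assumes "fin_graph G" "{u, v} \<in> edges G"
  shows "u \<in> verts G" "v \<in> verts G" "u \<noteq> v"
  using assms by (auto simp: fin_graph_def)

lemma graph_iso_refl: "G \<simeq> G"
  unfolding graph_iso_def by (rule exI[of _ id]) auto

lemma graph_iso_sym:
  assumes "G \<simeq> H" shows "H \<simeq> G"
proof -
  obtain f where f: "bij_betw f (verts G) (verts H)"
    "\<And>u v. u \<in> verts G \<Longrightarrow> v \<in> verts G \<Longrightarrow> {u, v} \<in> edges G \<longleftrightarrow> {f u, f v} \<in> edges H"
    using assms unfolding graph_iso_def by blast
  let ?g = "the_inv_into (verts G) f"
  have g: "bij_betw ?g (verts H) (verts G)" using f(1) by (rule bij_betw_the_inv_into)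
  have "{u, v} \<in> edges H \<longleftrightarrow> {?g u, ?g v} \<in> edges G" if "u \<in> verts H" "v \<in> verts H" for u v
    using f(2)[of "?g u" "?g v"] bij_betw_apply[OF g] f_the_inv_into_f_bij_betw[OF f(1)] that by simp
  then show ?thesis using g unfolding graph_iso_def by blast
qed

lemma graph_iso_trans [trans]:
  assumes "G \<simeq> H" "H \<simeq> K" shows "G \<simeq> K"
proof -
  obtain f where f: "bij_betw f (verts G) (verts H)"
    "\<And>u v. u \<in> verts G \<Longrightarrow> v \<in> verts G \<Longrightarrow> {u, v} \<in> edges G \<longleftrightarrow> {f u, f v} \<in> edges H"
    using assms unfolding graph_iso_def by blast
  obtain g where g: "bij_betw g (verts H) (verts K)"
    "\<And>u v. u \<in> verts H \<Longrightarrow> v \<in> verts H \<Longrightarrow> {u, v} \<in> edges H \<longleftrightarrow> {g u, g v} \<in> edges K"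
    using assms unfolding graph_iso_def by blast
  have "bij_betw (g \<circ> f) (verts G) (verts K)" using f(1) g(1) by (rule bij_betw_trans)
  moreover have "{u, v} \<in> edges G \<longleftrightarrow> {(g \<circ> f) u, (g \<circ> f) v} \<in> edges K"
    if "u \<in> verts G" "v \<in> verts G" for u v
    using f(2)[OF that] g(2)[of "f u" "f v"] that bij_betwE[OF f(1)] by auto
  ultimately show ?thesis unfolding graph_iso_def by blast
qed

text \<open>One injection replaces the vertex set and the isomorphism in
  \<open>\<subseteq>\<^sub>i\<close>, so that containments can be composed, complemented and glued
  as functions.\<close>

definition embeds :: "(nat \<Rightarrow> nat) \<Rightarrow> ugraph \<Rightarrow> ugraph \<Rightarrow> bool" where
  "embeds f H G \<longleftrightarrow> inj_on f (verts H) \<and> f ` verts H \<subseteq> verts G \<and>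
     (\<forall>u\<in>verts H. \<forall>v\<in>verts H. {u, v} \<in> edges H \<longleftrightarrow> {f u, f v} \<in> edges G)"

lemma induced_sub_iff_embeds: "H \<subseteq>\<^sub>i G \<longleftrightarrow> (\<exists>f. embeds f H G)"
proof
  assume "H \<subseteq>\<^sub>i G"
  then obtain W f where W: "W \<subseteq> verts G" and f: "bij_betw f (verts H) W"
    "\<And>u v. u \<in> verts H \<Longrightarrow> v \<in> verts H \<Longrightarrow> {u, v} \<in> edges H \<longleftrightarrow> {f u, f v} \<in> edges (induced G W)"
    unfolding induced_sub_def graph_iso_def induced_def by auto
  have "embeds f H G"
    unfolding embeds_def using W f(1) f(2) by (auto simp: bij_betw_def induced_def)
  then show "\<exists>f. embeds f H G" by blast
next
  assume "\<exists>f. embeds f H G"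
  then obtain f where f: "embeds f H G" ..
  have "H \<simeq> induced G (f ` verts H)"
    unfolding graph_iso_def
    by (rule exI[of _ f]) (use f in \<open>auto simp: embeds_def bij_betw_def induced_def\<close>)
  then show "H \<subseteq>\<^sub>i G" unfolding induced_sub_def using f by (auto simp: embeds_def)
qed

lemma graph_iso_imp_induced_sub: "G \<simeq> H \<Longrightarrow> G \<subseteq>\<^sub>i H"
  unfolding induced_sub_iff_embeds graph_iso_def embeds_def bij_betw_def by blast

lemma induced_sub_refl: "G \<subseteq>\<^sub>i G"
  by (rule graph_iso_imp_induced_sub[OF graph_iso_refl])

lemma induced_sub_trans [trans]:
  assumes "G \<subseteq>\<^sub>i H" "H \<subseteq>\<^sub>i K" shows "G \<subseteq>\<^sub>i K"
proof -
  obtain f g where f: "embeds f G H" and g: "embeds g H K"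
    using assms unfolding induced_sub_iff_embeds by blast
  have "embeds (g \<circ> f) G K"
    unfolding embeds_def
  proof (intro conjI ballI)
    show "inj_on (g \<circ> f) (verts G)"
      using f g unfolding embeds_def by (meson comp_inj_on inj_on_subset)
    show "(g \<circ> f) ` verts G \<subseteq> verts K" using f g unfolding embeds_def by fastforce
    fix u v assume "u \<in> verts G" "v \<in> verts G"
    then show "{u, v} \<in> edges G \<longleftrightarrow> {(g \<circ> f) u, (g \<circ> f) v} \<in> edges K"
      using f g unfolding embeds_def by (auto simp: image_subset_iff)
  qed
  then show ?thesis unfolding induced_sub_iff_embeds by blast
qed

lemma induced_sub_iso_left: "G \<simeq> G' \<Longrightarrow> G \<subseteq>\<^sub>i H \<longleftrightarrow> G' \<subseteq>\<^sub>i H"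
  by (meson graph_iso_imp_induced_sub graph_iso_sym induced_sub_trans)

lemma induced_sub_iso_right: "H \<simeq> H' \<Longrightarrow> G \<subseteq>\<^sub>i H \<longleftrightarrow> G \<subseteq>\<^sub>i H'"
  by (meson graph_iso_imp_induced_sub graph_iso_sym induced_sub_trans)

lemma graph_iso_cong_right: "H \<simeq> H' \<Longrightarrow> G \<simeq> H \<longleftrightarrow> G \<simeq> H'"
  by (meson graph_iso_sym graph_iso_trans)

lemma induced_sub_card_le:
  assumes "fin_graph G" "H \<subseteq>\<^sub>i G" shows "card (verts H) \<le> card (verts G)"
  using assms unfolding induced_sub_iff_embeds embeds_def fin_graph_def
  by (metis card_inj_on_le)

lemma induced_sub_card_eq_imp_iso:
  assumes "fin_graph G" "H \<subseteq>\<^sub>i G" "card (verts G) \<le> card (verts H)" shows "H \<simeq> G"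
proof -
  obtain f where f: "embeds f H G" using assms(2) unfolding induced_sub_iff_embeds ..
  have "f ` verts H = verts G"
    using f assms unfolding embeds_def fin_graph_def by (intro card_seteq) (auto simp: card_image)
  then show ?thesis using f unfolding graph_iso_def embeds_def bij_betw_def by blast
qed

text \<open>Mutual containment forces equal vertex counts, and an embedding between finite vertex
  sets of equal size is onto.\<close>

lemma induced_sub_antisym:
  assumes "fin_graph G" "fin_graph H" "H \<subseteq>\<^sub>i G" "G \<subseteq>\<^sub>i H" shows "H \<simeq> G"
  using assms induced_sub_card_eq_imp_iso induced_sub_card_le by blast

lemma card_eq_of_iso: "G \<simeq> H \<Longrightarrow> card (verts G) = card (verts H)"
  unfolding graph_iso_def using bij_betw_same_card by blast

lemma verts_co [simp]: "verts (co G) = verts G"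
  by (simp add: co_def)

lemma edges_co: "{u, v} \<in> edges (co G) \<longleftrightarrow>
    u \<in> verts G \<and> v \<in> verts G \<and> u \<noteq> v \<and> {u, v} \<notin> edges G"
  by (cases "u = v") (auto simp: co_def)

lemma fin_graph_co [simp]: "fin_graph G \<Longrightarrow> fin_graph (co G)"
  by (auto simp: fin_graph_def co_def)

lemma co_co [simp]: "fin_graph G \<Longrightarrow> co (co G) = G"
  by (cases G) (auto simp: fin_graph_def co_def)

lemma embeds_co:
  assumes "fin_graph H" "fin_graph G" "embeds f H G" shows "embeds f (co H) (co G)"
  using assms(3) unfolding embeds_def verts_co edges_co by (auto dest: inj_onD)

lemma co_mono:
  assumes "fin_graph H" "fin_graph G" "H \<subseteq>\<^sub>i G" shows "co H \<subseteq>\<^sub>i co G"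
  using assms embeds_co unfolding induced_sub_iff_embeds by blast

lemma co_induced_sub_iff:
  assumes "fin_graph H" "fin_graph G" shows "co H \<subseteq>\<^sub>i co G \<longleftrightarrow> H \<subseteq>\<^sub>i G"
  using assms co_mono[of H G] co_mono[of "co H" "co G"] by auto

lemma co_iso:
  assumes "fin_graph H" "fin_graph G" "H \<simeq> G" shows "co H \<simeq> co G"
  using assms by (intro induced_sub_antisym co_mono)
    (auto intro: graph_iso_imp_induced_sub graph_iso_sym)

lemma verts_induced [simp]: "verts (induced G W) = W"
  by (simp add: induced_def)

lemma edges_induced: "{u, v} \<in> edges (induced G W) \<longleftrightarrow> {u, v} \<in> edges G \<and> u \<in> W \<and> v \<in> W"
  by (simp add: induced_def)

lemma fin_graph_induced: "fin_graph G \<Longrightarrow> W \<subseteq> verts G \<Longrightarrow> fin_graph (induced G W)"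
  by (auto simp: fin_graph_def induced_def intro: finite_subset)

lemma induced_induced_sub: "W \<subseteq> verts G \<Longrightarrow> induced G W \<subseteq>\<^sub>i G"
  unfolding induced_sub_def using graph_iso_refl by blast

text \<open>No class contains a graph that it forbids, so each of the four graphs lies above one of
  the other pair. By incomparability, a graph of the second pair below \<open>A\<close> is
  isomorphic to \<open>A\<close> and not below \<open>B\<close>; hence different graphs answer for
  \<open>A\<close> and \<open>B\<close>.\<close>

lemma Free_eq_incomparable:
  assumes fin: "fin_graph A" "fin_graph B" "fin_graph C" "fin_graph D"
    and inc: "\<not> A \<subseteq>\<^sub>i B" "\<not> B \<subseteq>\<^sub>i A" and eq: "Free A B = Free C D"
  shows "(C \<simeq> A \<and> D \<simeq> B) \<or> (C \<simeq> B \<and> D \<simeq> A)"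
proof -
  have iff: "A \<subseteq>\<^sub>i G \<or> B \<subseteq>\<^sub>i G \<longleftrightarrow> C \<subseteq>\<^sub>i G \<or> D \<subseteq>\<^sub>i G" if "fin_graph G" for G
  proof -
    have "G \<in> Free A B \<longleftrightarrow> G \<in> Free C D" using eq by simp
    then show ?thesis using that by (auto simp: Free_def)
  qed
  have sub: "A \<subseteq>\<^sub>i C \<or> B \<subseteq>\<^sub>i C" "A \<subseteq>\<^sub>i D \<or> B \<subseteq>\<^sub>i D" "C \<subseteq>\<^sub>i A \<or> D \<subseteq>\<^sub>i A" "C \<subseteq>\<^sub>i B \<or> D \<subseteq>\<^sub>i B"
    using iff[OF fin(1)] iff[OF fin(2)] iff[OF fin(3)] iff[OF fin(4)] induced_sub_refl by auto
  have "X \<simeq> A \<and> \<not> X \<subseteq>\<^sub>i B" if "X \<subseteq>\<^sub>i A" "A \<subseteq>\<^sub>i X \<or> B \<subseteq>\<^sub>i X" "fin_graph X" for X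
    using that inc fin induced_sub_antisym[of A X] induced_sub_trans[of B X A] induced_sub_trans[of A X B]
    by blast
  moreover have "X \<simeq> B" if "X \<subseteq>\<^sub>i B" "A \<subseteq>\<^sub>i X \<or> B \<subseteq>\<^sub>i X" "fin_graph X" for X
    using that inc fin induced_sub_antisym[of B X] induced_sub_trans[of A X B] by blast
  ultimately show ?thesis using sub fin by blast
qed

text \<open>For finite graphs this is acyclicity, phrased as 1-degeneracy.\<close>

definition forest_like :: "ugraph \<Rightarrow> bool" where
  "forest_like G \<longleftrightarrow> (\<forall>W\<subseteq>verts G. W \<noteq> {} \<longrightarrow>
     (\<exists>v\<in>W. \<exists>x. \<forall>u\<in>W. {u, v} \<in> edges G \<longrightarrow> u = x))"

lemma forest_like_embeds:
  assumes "forest_like G" "embeds f H G" shows "forest_like H"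
  unfolding forest_like_def
proof (intro allI impI)
  fix W assume W: "W \<subseteq> verts H" "W \<noteq> {}"
  have inj: "inj_on f W" and sub: "f ` W \<subseteq> verts G"
    using W assms(2) unfolding embeds_def by (auto dest: inj_on_subset)
  have edge: "{f u, f v} \<in> edges G" if "u \<in> W" "v \<in> W" "{u, v} \<in> edges H" for u v
    using subsetD[OF W(1)] assms(2) that unfolding embeds_def by simp
  have "\<exists>v\<in>f ` W. \<exists>x. \<forall>u\<in>f ` W. {u, v} \<in> edges G \<longrightarrow> u = x"
    using assms(1) sub W(2) unfolding forest_like_def by blast
  then obtain v x where v: "v \<in> W" "\<forall>u\<in>W. {f u, f v} \<in> edges G \<longrightarrow> f u = x"
    by auto
  \<comment> \<open>If \<open>x\<close> is not an image, this value is arbitrary, and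
    \<open>v\<close> then has no neighbour in \<open>W\<close>.\<close>
  have "u = the_inv_into W f x" if "u \<in> W" "{u, v} \<in> edges H" for u
    using v(2) that(1) edge[OF that(1) v(1) that(2)] the_inv_into_f_f[OF inj that(1)] by auto
  then show "\<exists>v\<in>W. \<exists>x. \<forall>u\<in>W. {u, v} \<in> edges H \<longrightarrow> u = x" using v(1) by blast
qed

lemma forest_like_induced_sub: "forest_like G \<Longrightarrow> H \<subseteq>\<^sub>i G \<Longrightarrow> forest_like H"
  unfolding induced_sub_iff_embeds using forest_like_embeds by blast

section \<open>Codes for forests\<close>

text \<open>
  A forest is coded by a parent list: entry \<open>i\<close> is the only neighbour of vertex \<open>i\<close> among the
  smaller vertices, if there is one. Entries that do not point to a smaller vertex are ignored.
\<close>

type_synonym forest_code = "nat option list"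

definition code_graph :: "forest_code \<Rightarrow> ugraph" where
  "code_graph p = ({..<length p}, {{i, j} | i j. i < length p \<and> j < i \<and> p ! i = Some j})"

text \<open>An executable adjacency test. It ignores the bounds on vertices, which
  \<open>edges_code_graph\<close> adds.\<close>

definition code_adj :: "forest_code \<Rightarrow> nat \<Rightarrow> nat \<Rightarrow> bool" where
  "code_adj p u v = (if u < v then p ! v = Some u else if v < u then p ! u = Some v else False)"

lemma code_adj_commute: "code_adj p u v = code_adj p v u"
  by (simp add: code_adj_def)

lemma verts_code_graph [simp]: "verts (code_graph p) = {..<length p}"
  by (simp add: code_graph_def)

lemma edges_code_graph:
  "{u, v} \<in> edges (code_graph p) \<longleftrightarrow> u < length p \<and> v < length p \<and> code_adj p u v"
  by (auto simp: code_graph_def code_adj_def doubleton_eq_iff split: if_splits)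

lemma fin_graph_code_graph [simp]: "fin_graph (code_graph p)"
  by (auto simp: fin_graph_def code_graph_def)

text \<open>The largest vertex of \<open>W\<close> can have only its parent as a neighbour in
  \<open>W\<close>.\<close>

lemma forest_like_code_graph: "forest_like (code_graph p)"
  unfolding forest_like_def
proof (intro allI impI)
  fix W assume W: "W \<subseteq> verts (code_graph p)" "W \<noteq> {}"
  then have fin: "finite W" by (auto intro: finite_subset)
  have "u = the (p ! Max W)" if "u \<in> W" "{u, Max W} \<in> edges (code_graph p)" for u
    using that Max_ge[OF fin that(1)] by (auto simp: edges_code_graph code_adj_def split: if_splits)
  then show "\<exists>v\<in>W. \<exists>x. \<forall>u\<in>W. {u, v} \<in> edges (code_graph p) \<longrightarrow> u = x"
    using Max_in[OF fin W(2)] by blast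
qed

text \<open>
  A backtracking search for an induced embedding; \<open>ys\<close> holds the images of the vertices placed so
  far. The conditionals stand for conjunctions and disjunctions because rewriting with code
  equations evaluates both arguments of the latter.
\<close>

primrec fits :: "forest_code \<Rightarrow> nat option \<Rightarrow> nat \<Rightarrow> nat \<Rightarrow> nat list \<Rightarrow> bool" where
  "fits q c x i [] = True"
| "fits q c x i (y # ys) =
     (if y \<noteq> x \<and> (c = Some i) = code_adj q y x then fits q c x (Suc i) ys else False)"

fun extends :: "forest_code \<Rightarrow> forest_code \<Rightarrow> nat list \<Rightarrow> nat list \<Rightarrow> bool" where
  "extends q [] ys xs = True"
| "extends q (c # p) ys [] = False"
| "extends q (c # p) ys (x # xs) =
     (if (if fits q c x 0 ys then extends q p (ys @ [x]) [0..<length q] else False) then True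
      else extends q (c # p) ys xs)"

definition code_sub :: "forest_code \<Rightarrow> forest_code \<Rightarrow> bool" where
  "code_sub p q = extends q p [] [0..<length q]"

lemma fits_iff:
  "fits q c x n ys \<longleftrightarrow> (\<forall>i<length ys. ys ! i \<noteq> x \<and> (c = Some (n + i)) = code_adj q (ys ! i) x)"
  by (induction ys arbitrary: n) (auto simp: All_less_Suc2)

lemma extends_Cons_iff:
  "extends q (c # p) ys xs \<longleftrightarrow> (\<exists>x\<in>set xs. fits q c x 0 ys \<and> extends q p (ys @ [x]) [0..<length q])"
  by (induction xs) auto

text \<open>A successful branch is recorded as the list \<open>g\<close> of all images;
  \<open>ys @ take k g\<close> is the state of the search when entry \<open>k\<close> of
  \<open>p\<close> is placed.\<close>

lemma extends_iff:
  "extends q p ys [0..<length q] \<longleftrightarrow> (\<exists>g. length g = length p \<and>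
     (\<forall>k<length p. g ! k < length q \<and> fits q (p ! k) (g ! k) 0 (ys @ take k g)))"
proof (induction p arbitrary: ys)
  case Nil
  show ?case by simp
next
  case (Cons c p)
  let ?ok = "\<lambda>c p ys x g. \<forall>k<length (c # p). (x # g) ! k < length q \<and>
     fits q ((c # p) ! k) ((x # g) ! k) 0 (ys @ take k (x # g))"
  have "extends q (c # p) ys [0..<length q] \<longleftrightarrow>
      (\<exists>x<length q. fits q c x 0 ys \<and> extends q p (ys @ [x]) [0..<length q])"
    unfolding extends_Cons_iff by (auto simp: Bex_def)
  also have "\<dots> \<longleftrightarrow> (\<exists>x g. length g = length p \<and> ?ok c p ys x g)"
    unfolding Cons.IH length_Cons All_less_Suc2 by auto
  also have "\<dots> \<longleftrightarrow> (\<exists>g. length g = length (c # p) \<and>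
     (\<forall>k<length (c # p). g ! k < length q \<and> fits q ((c # p) ! k) (g ! k) 0 (ys @ take k g)))"
    (is "_ \<longleftrightarrow> (\<exists>g. ?R g)")
  proof
    assume "\<exists>x g. length g = length p \<and> ?ok c p ys x g"
    then obtain x g where "length g = length p" "?ok c p ys x g" by blast
    then have "?R (x # g)" by simp
    then show "\<exists>g. ?R g" by blast
  next
    assume "\<exists>g. ?R g"
    then obtain g where g: "?R g" ..
    then obtain x g' where "g = x # g'" by (cases g) auto
    then show "\<exists>x g. length g = length p \<and> ?ok c p ys x g" using g by (intro exI[of _ x] exI[of _ g']) simp
  qed
  finally show ?case .
qed

text \<open>Turns every containment between fixed forests into a computation. The search compares a
  vertex only with earlier ones; symmetry of adjacency supplies the other order.\<close>

lemma code_sub_iff: "code_graph p \<subseteq>\<^sub>i code_graph q \<longleftrightarrow> code_sub p q"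
proof -
  have spec: "code_sub p q \<longleftrightarrow> (\<exists>g. length g = length p \<and> (\<forall>k<length p. g ! k < length q \<and>
      (\<forall>i<k. g ! i \<noteq> g ! k \<and> (p ! k = Some i) = code_adj q (g ! i) (g ! k))))"
    unfolding code_sub_def extends_iff fits_iff by (auto simp: min_def cong: conj_cong)
  show ?thesis
  proof
    assume "code_graph p \<subseteq>\<^sub>i code_graph q"
    then obtain f where f: "embeds f (code_graph p) (code_graph q)"
      unfolding induced_sub_iff_embeds by blast
    have "f k < length q" if "k < length p" for k
      using f that unfolding embeds_def by auto
    moreover have "f i \<noteq> f k" if "k < length p" "i < k" for i k
      using f that unfolding embeds_def by (auto dest: inj_onD)
    moreover have "(p ! k = Some i) = code_adj q (f i) (f k)" if "k < length p" "i < k" for i k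
    proof -
      have "{i, k} \<in> edges (code_graph p) \<longleftrightarrow> {f i, f k} \<in> edges (code_graph q)"
        using f that unfolding embeds_def by simp
      then show ?thesis using that calculation(1) unfolding edges_code_graph
        by (simp add: code_adj_def)
    qed
    ultimately show "code_sub p q" unfolding spec by (intro exI[of _ "map f [0..<length p]"]) simp
  next
    assume "code_sub p q"
    then obtain g where g: "length g = length p" "\<And>k. k < length p \<Longrightarrow> g ! k < length q"
      "\<And>i k. k < length p \<Longrightarrow> i < k \<Longrightarrow> g ! i \<noteq> g ! k"
      "\<And>i k. k < length p \<Longrightarrow> i < k \<Longrightarrow> (p ! k = Some i) = code_adj q (g ! i) (g ! k)"
      unfolding spec by blast
    have "embeds ((!) g) (code_graph p) (code_graph q)"
      unfolding embeds_def
    proof (intro conjI ballI)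
      show "inj_on ((!) g) (verts (code_graph p))"
        using g(3) by (intro linorder_inj_onI) auto
      show "(!) g ` verts (code_graph p) \<subseteq> verts (code_graph q)" using g(2) by auto
      fix u v assume uv: "u \<in> verts (code_graph p)" "v \<in> verts (code_graph p)"
      have "code_adj p u v = code_adj q (g ! u) (g ! v)"
      proof (cases u v rule: linorder_cases)
        case less then show ?thesis using g(4) uv by (simp add: code_adj_def)
      next
        case equal then show ?thesis by (simp add: code_adj_def)
      next
        case greater then show ?thesis using g(4) uv
          by (simp add: code_adj_def[of p] code_adj_commute[of q "g ! u"])
      qed
      then show "{u, v} \<in> edges (code_graph p) \<longleftrightarrow> {g ! u, g ! v} \<in> edges (code_graph q)"
        using g(2) uv by (simp add: edges_code_graph)
    qed
    then show "code_graph p \<subseteq>\<^sub>i code_graph q" unfolding induced_sub_iff_embeds by blast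
  qed
qed

lemma code_graph_iso:
  assumes "length p = length q" "code_sub p q" shows "code_graph p \<simeq> code_graph q"
  using assms by (intro induced_sub_card_eq_imp_iso) (simp_all add: code_sub_iff)

section \<open>Codes of disjoint unions, paths and subdivided claws\<close>

definition code_union :: "forest_code \<Rightarrow> forest_code \<Rightarrow> forest_code" (infixl "\<boxplus>" 65) where
  "p \<boxplus> q = p @ map (map_option (\<lambda>j. j + length p)) q"

primrec code_copies :: "nat \<Rightarrow> forest_code \<Rightarrow> forest_code" (infixr "\<odot>" 75) where
  "0 \<odot> p = []"
| "Suc s \<odot> p = p \<boxplus> s \<odot> p"

definition code_path :: "nat \<Rightarrow> forest_code" ("\<pi>") where
  "\<pi> r = map (\<lambda>m. case m of 0 \<Rightarrow> None | Suc n \<Rightarrow> Some n) [0..<r]"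

text \<open>The vertices \<open>i + 1\<close> and \<open>i + j + 1\<close> open the second and third
  leg, so they hang on the centre 0 instead of on their predecessor.\<close>

definition code_S :: "nat \<Rightarrow> nat \<Rightarrow> nat \<Rightarrow> forest_code" ("\<sigma>") where
  "\<sigma> i j k = map (\<lambda>m. case m of 0 \<Rightarrow> None
     | Suc n \<Rightarrow> Some (if n = i \<or> n = i + j then 0 else n)) [0..<Suc (i + j + k)]"

lemma graph_eqI:
  assumes "fin_graph G" "fin_graph H" "verts G = verts H"
    "\<And>u v. u \<in> verts H \<Longrightarrow> v \<in> verts H \<Longrightarrow> u < v \<Longrightarrow> {u, v} \<in> edges G \<longleftrightarrow> {u, v} \<in> edges H"
  shows "G = H"
proof -
  have "e \<in> edges G \<longleftrightarrow> e \<in> edges H" for e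
  proof (cases "e \<subseteq> verts H \<and> card e = 2")
    case True
    then obtain x y where "e = {x, y}" "x \<noteq> y" by (auto simp: card_2_iff)
    then obtain u v where "e = {u, v}" "u < v" by (metis insert_commute linorder_neqE_nat)
    then show ?thesis using assms(4) True by auto
  next
    case False
    then show ?thesis using assms(1-3) unfolding fin_graph_def by auto
  qed
  then show ?thesis using assms(3) by (auto simp: prod_eq_iff)
qed

lemma verts_Path [simp]: "verts (Path r) = {..<r}"
  by (simp add: Path_def)

lemma edges_Path: "u < v \<Longrightarrow> {u, v} \<in> edges (Path r) \<longleftrightarrow> v = Suc u \<and> v < r"
  by (auto simp: Path_def doubleton_eq_iff)

lemma fin_graph_Path: "fin_graph (Path r)"
  by (auto simp: fin_graph_def Path_def)

lemma Path_eq: "Path r = code_graph (\<pi> r)"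
proof (rule graph_eqI)
  fix u v assume "v \<in> verts (code_graph (\<pi> r))" "u < v"
  then show "{u, v} \<in> edges (Path r) \<longleftrightarrow> {u, v} \<in> edges (code_graph (\<pi> r))"
    unfolding edges_Path[OF \<open>u < v\<close>] edges_code_graph
    by (auto simp: code_adj_def code_path_def split: nat.splits)
qed (auto simp: fin_graph_Path code_path_def)

lemma verts_S_tree [simp]: "verts (S_tree i j k) = {..i + j + k}"
  by (simp add: S_tree_def)

lemma edges_S_tree:
  assumes "u < v" "1 \<le> i" "1 \<le> j" "1 \<le> k"
  shows "{u, v} \<in> edges (S_tree i j k) \<longleftrightarrow> v \<le> i + j + k \<and>
     (if v = i + 1 \<or> v = i + j + 1 then u = 0 else v = Suc u)"
  using assms by (auto simp: S_tree_def doubleton_eq_iff)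

lemma fin_graph_S_tree:
  assumes "1 \<le> j" "1 \<le> k" shows "fin_graph (S_tree i j k)"
  using assms by (auto simp: fin_graph_def S_tree_def)

lemma S_tree_eq:
  assumes "1 \<le> i" "1 \<le> j" "1 \<le> k"
  shows "S_tree i j k = code_graph (\<sigma> i j k)"
proof (rule graph_eqI)
  fix u v assume "v \<in> verts (code_graph (\<sigma> i j k))" "u < v"
  then show "{u, v} \<in> edges (S_tree i j k) \<longleftrightarrow> {u, v} \<in> edges (code_graph (\<sigma> i j k))"
    unfolding edges_S_tree[OF \<open>u < v\<close> assms] edges_code_graph
    by (cases v) (auto simp: code_adj_def code_S_def simp del: upt_Suc)
qed (use assms in \<open>auto simp: fin_graph_S_tree code_S_def\<close>)

lemma Claw_eq: "Claw = code_graph (\<sigma> 1 1 1)"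
proof -
  have "Claw = S_tree 1 1 1"
  proof (rule graph_eqI)
    fix u v :: nat assume "u < v"
    have "{u, v} \<in> edges Claw \<longleftrightarrow> u = 0 \<and> (v = 1 \<or> v = 2 \<or> v = 3)"
      using \<open>u < v\<close> by (auto simp: Claw_def doubleton_eq_iff)
    also have "\<dots> \<longleftrightarrow> {u, v} \<in> edges (S_tree 1 1 1)"
      unfolding edges_S_tree[OF \<open>u < v\<close> order_refl order_refl order_refl] using \<open>u < v\<close>
      by (auto split: if_splits)
    finally show "{u, v} \<in> edges Claw \<longleftrightarrow> {u, v} \<in> edges (S_tree 1 1 1)" .
  qed (auto simp: fin_graph_S_tree, auto simp: fin_graph_def Claw_def)
  then show ?thesis by (simp add: S_tree_eq)
qed

lemma verts_disj_union: "verts (G \<oplus> H) = (\<lambda>n. 2 * n) ` verts G \<union> (\<lambda>n. 2 * n + 1) ` verts H"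
  by (simp add: disj_union_def)

lemma image_eq_doubleton:
  assumes "inj h" shows "{h a, h b} = h ` e \<longleftrightarrow> e = {a, b}"
  using inj_image_eq_iff[OF assms, of "{a, b}" e] by auto

lemma edges_disj_union:
  "{2 * a, 2 * b} \<in> edges (G \<oplus> H) \<longleftrightarrow> {a, b} \<in> edges G"
  "{2 * a + 1, 2 * b + 1} \<in> edges (G \<oplus> H) \<longleftrightarrow> {a, b} \<in> edges H"
  "{2 * a, 2 * b + 1} \<notin> edges (G \<oplus> H)" "{2 * b + 1, 2 * a} \<notin> edges (G \<oplus> H)"
proof -
  have inj: "inj (\<lambda>n::nat. 2 * n)" "inj (\<lambda>n::nat. 2 * n + 1)" by (auto simp: inj_def)
  have mixed: "{2 * a, 2 * b + 1} \<noteq> (\<lambda>n. 2 * n) ` e" "{2 * a, 2 * b + 1} \<noteq> (\<lambda>n. 2 * n + 1) ` e"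
    for a b :: nat and e
  proof -
    have "2 * b + 1 \<notin> (\<lambda>n. 2 * n) ` e" "2 * a \<notin> (\<lambda>n. 2 * n + 1) ` e" by (auto simp: image_iff) presburger+
    then show "{2 * a, 2 * b + 1} \<noteq> (\<lambda>n. 2 * n) ` e" "{2 * a, 2 * b + 1} \<noteq> (\<lambda>n. 2 * n + 1) ` e"
      by blast+
  qed
  have even: "{2 * a, 2 * b} \<noteq> (\<lambda>n. 2 * n + 1) ` e" and odd: "{2 * a + 1, 2 * b + 1} \<noteq> (\<lambda>n. 2 * n) ` e"
    for a b :: nat and e
  proof -
    have "2 * a \<notin> (\<lambda>n. 2 * n + 1) ` e" "2 * a + 1 \<notin> (\<lambda>n. 2 * n) ` e" by (auto simp: image_iff) presburger+
    then show "{2 * a, 2 * b} \<noteq> (\<lambda>n. 2 * n + 1) ` e" "{2 * a + 1, 2 * b + 1} \<noteq> (\<lambda>n. 2 * n) ` e"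
      by blast+
  qed
  show "{2 * a, 2 * b} \<in> edges (G \<oplus> H) \<longleftrightarrow> {a, b} \<in> edges G"
    unfolding disj_union_def snd_conv Un_iff image_iff[of _ "(`) _"]
    using even image_eq_doubleton[OF inj(1)] by auto
  show "{2 * a + 1, 2 * b + 1} \<in> edges (G \<oplus> H) \<longleftrightarrow> {a, b} \<in> edges H"
    unfolding disj_union_def snd_conv Un_iff image_iff[of _ "(`) _"]
    using odd image_eq_doubleton[OF inj(2)] by auto
  show "{2 * a, 2 * b + 1} \<notin> edges (G \<oplus> H)"
    unfolding disj_union_def snd_conv Un_iff image_iff[of _ "(`) _"] using mixed by blast
  then show "{2 * b + 1, 2 * a} \<notin> edges (G \<oplus> H)" by (simp add: insert_commute)
qed

lemma fin_graph_disj_union: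
  assumes "fin_graph G" "fin_graph H" shows "fin_graph (G \<oplus> H)"
proof -
  have even: "(\<lambda>n. 2 * n) ` e \<subseteq> verts (G \<oplus> H) \<and> card ((\<lambda>n. 2 * n) ` e) = 2" if "e \<in> edges G" for e
  proof -
    have "e \<subseteq> verts G" "card e = 2" using assms(1) that by (auto simp: fin_graph_def)
    then show ?thesis unfolding verts_disj_union by (auto simp: card_image inj_on_def)
  qed
  have odd: "(\<lambda>n. 2 * n + 1) ` e \<subseteq> verts (G \<oplus> H) \<and> card ((\<lambda>n. 2 * n + 1) ` e) = 2"
    if "e \<in> edges H" for e
  proof -
    have "e \<subseteq> verts H" "card e = 2" using assms(2) that by (auto simp: fin_graph_def)
    then show ?thesis unfolding verts_disj_union by (auto simp: card_image inj_on_def)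
  qed
  have "edges (G \<oplus> H) = (`) (\<lambda>n. 2 * n) ` edges G \<union> (`) (\<lambda>n. 2 * n + 1) ` edges H"
    by (simp add: disj_union_def)
  also have "\<dots> \<subseteq> {e. e \<subseteq> verts (G \<oplus> H) \<and> card e = 2}"
    by (intro Un_least image_subsetI CollectI even odd)
  finally show ?thesis
    using assms unfolding fin_graph_def verts_disj_union by simp
qed

text \<open>Parity tells which side a vertex comes from, and \<open>n div 2\<close> recovers its old
  number on both sides.\<close>

lemma embeds_disj_unionI:
  assumes f: "embeds f G K" and g: "embeds g H K"
    and disj: "f ` verts G \<inter> g ` verts H = {}"
    and sep: "\<And>u v. u \<in> verts G \<Longrightarrow> v \<in> verts H \<Longrightarrow> {f u, g v} \<notin> edges K"
  shows "embeds (\<lambda>n. if even n then f (n div 2) else g (n div 2)) (G \<oplus> H) K"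
    (is "embeds ?h _ _")
  unfolding embeds_def
proof (intro conjI ballI)
  have verts: "(\<exists>a\<in>verts G. u = 2 * a) \<or> (\<exists>a\<in>verts H. u = 2 * a + 1)"
    if "u \<in> verts (G \<oplus> H)" for u using that unfolding verts_disj_union by auto
  have dist: "f a \<noteq> g b" if "a \<in> verts G" "b \<in> verts H" for a b using disj that by blast
  show "inj_on ?h (verts (G \<oplus> H))"
  proof (rule inj_onI)
    fix u v assume "u \<in> verts (G \<oplus> H)" "v \<in> verts (G \<oplus> H)" "?h u = ?h v"
    then show "u = v" using verts[of u] verts[of v] f g unfolding embeds_def
      by (auto dest: inj_onD dest: dist dist[symmetric])
  qed
  show "?h ` verts (G \<oplus> H) \<subseteq> verts K"
    using f g unfolding embeds_def by (auto dest!: verts)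
  fix u v assume "u \<in> verts (G \<oplus> H)" "v \<in> verts (G \<oplus> H)"
  then show "{u, v} \<in> edges (G \<oplus> H) \<longleftrightarrow> {?h u, ?h v} \<in> edges K"
    using verts[of u] verts[of v] f g sep unfolding embeds_def
    by (auto simp: edges_disj_union edges_disj_union[simplified] insert_commute)
qed

lemma card_verts_disj_union:
  assumes "fin_graph G" "fin_graph H"
  shows "card (verts (G \<oplus> H)) = card (verts G) + card (verts H)"
proof -
  have "(\<lambda>n. 2 * n) ` verts G \<inter> (\<lambda>n. 2 * n + 1) ` verts H = {}" by (auto; presburger)
  then show ?thesis using assms unfolding verts_disj_union fin_graph_def
    by (subst card_Un_disjoint) (auto simp: card_image inj_on_def)
qed

lemma disj_union_mono:
  assumes "G \<subseteq>\<^sub>i G'" "H \<subseteq>\<^sub>i H'" shows "G \<oplus> H \<subseteq>\<^sub>i G' \<oplus> H'"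
proof -
  obtain f g where f: "embeds f G G'" and g: "embeds g H H'"
    using assms unfolding induced_sub_iff_embeds by blast
  have "embeds (\<lambda>n. 2 * f n) G (G' \<oplus> H')" "embeds (\<lambda>n. 2 * g n + 1) H (G' \<oplus> H')"
    using f g unfolding embeds_def verts_disj_union by (auto simp: inj_on_def edges_disj_union edges_disj_union[simplified])
  moreover have "(\<lambda>n. 2 * f n) ` verts G \<inter> (\<lambda>n. 2 * g n + 1) ` verts H = {}" by (auto; presburger)
  moreover have "{2 * f u, 2 * g v + 1} \<notin> edges (G' \<oplus> H')" for u v by (rule edges_disj_union(3))
  ultimately have "embeds (\<lambda>n. if even n then 2 * f (n div 2) else 2 * g (n div 2) + 1) (G \<oplus> H) (G' \<oplus> H')"
    by (rule embeds_disj_unionI)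
  then show ?thesis unfolding induced_sub_iff_embeds by blast
qed

lemma disj_union_iso:
  assumes "fin_graph G'" "fin_graph H'" "G \<simeq> G'" "H \<simeq> H'" "fin_graph G" "fin_graph H"
  shows "G \<oplus> H \<simeq> G' \<oplus> H'"
proof (rule induced_sub_card_eq_imp_iso)
  show "fin_graph (G' \<oplus> H')" using assms by (simp add: fin_graph_disj_union)
  show "G \<oplus> H \<subseteq>\<^sub>i G' \<oplus> H'" using assms by (simp add: disj_union_mono graph_iso_imp_induced_sub)
  show "card (verts (G' \<oplus> H')) \<le> card (verts (G \<oplus> H))"
    using assms by (simp add: card_verts_disj_union card_eq_of_iso[of G G'] card_eq_of_iso[of H H'])
qed

text \<open>Only an embedding is constructed, the second graph being shifted behind the first; equal
  vertex counts make it an isomorphism.\<close>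

lemma code_graph_union: "code_graph p \<oplus> code_graph q \<simeq> code_graph (p \<boxplus> q)"
proof (rule induced_sub_card_eq_imp_iso)
  have adj: "code_adj (p \<boxplus> q) u v = code_adj p u v" if "u < length p" "v < length p" for u v
    using that by (simp add: code_adj_def code_union_def nth_append)
  have adj': "code_adj (p \<boxplus> q) (u + length p) (v + length p) = code_adj q u v"
    if "u < length q" "v < length q" for u v
    using that by (cases "q ! u"; cases "q ! v") (auto simp: code_adj_def code_union_def nth_append)
  have sep: "\<not> code_adj (p \<boxplus> q) u (v + length p)" if "u < length p" "v < length q" for u v
    using that by (cases "q ! v") (auto simp: code_adj_def code_union_def nth_append)
  have len: "length (p \<boxplus> q) = length p + length q" by (simp add: code_union_def)
  have "embeds (\<lambda>n. n) (code_graph p) (code_graph (p \<boxplus> q))"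
    unfolding embeds_def edges_code_graph by (auto simp: adj len)
  moreover have "embeds (\<lambda>n. n + length p) (code_graph q) (code_graph (p \<boxplus> q))"
    unfolding embeds_def edges_code_graph by (auto simp: adj' len inj_on_def)
  moreover have "(\<lambda>n. n) ` verts (code_graph p) \<inter> (\<lambda>n. n + length p) ` verts (code_graph q) = {}"
    by auto
  moreover have "{u, v + length p} \<notin> edges (code_graph (p \<boxplus> q))"
    if "u \<in> verts (code_graph p)" "v \<in> verts (code_graph q)" for u v
    using that by (simp add: edges_code_graph sep)
  ultimately have "embeds (\<lambda>n. if even n then n div 2 else n div 2 + length p)
      (code_graph p \<oplus> code_graph q) (code_graph (p \<boxplus> q))"
    by (rule embeds_disj_unionI)
  then show "code_graph p \<oplus> code_graph q \<subseteq>\<^sub>i code_graph (p \<boxplus> q)"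
    unfolding induced_sub_iff_embeds by blast
qed (auto simp: card_verts_disj_union code_union_def)

text \<open>\<open>\<simeq>\<close> only compares pairs of vertices, so a malformed edge set could
  pass unnoticed; well-formedness is therefore recorded as well.\<close>

definition represents :: "forest_code \<Rightarrow> ugraph \<Rightarrow> bool" where
  "represents p G \<longleftrightarrow> fin_graph G \<and> G \<simeq> code_graph p"

lemma represents_Path: "represents (\<pi> r) (Path r)"
  by (simp add: represents_def Path_eq graph_iso_refl)

lemma represents_S_tree: "1 \<le> i \<Longrightarrow> 1 \<le> j \<Longrightarrow> 1 \<le> k \<Longrightarrow> represents (\<sigma> i j k) (S_tree i j k)"
  by (simp add: represents_def S_tree_eq graph_iso_refl)

lemma represents_Claw: "represents (\<sigma> 1 1 1) Claw"
  by (simp only: represents_def Claw_eq graph_iso_refl fin_graph_code_graph simp_thms)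

lemma represents_union:
  "represents p G \<Longrightarrow> represents q H \<Longrightarrow> represents (p \<boxplus> q) (G \<oplus> H)"
  unfolding represents_def
  using disj_union_iso[of "code_graph p" "code_graph q" G H] code_graph_union[of p q] fin_graph_disj_union
  by (auto intro: graph_iso_trans)

lemma represents_copies: "represents p G \<Longrightarrow> represents (s \<odot> p) (s \<cdot> G)"
proof (induction s)
  case 0
  have "({}, {}) = code_graph []" by (auto simp: code_graph_def)
  then show ?case by (simp add: represents_def graph_iso_refl)
next
  case (Suc s)
  then show ?case by (simp add: represents_union)
qed

lemmas represents_intros = represents_Path represents_Claw represents_S_tree represents_union represents_copies

section \<open>The class of disjoint unions of paths and subdivided claws\<close>

lemma component_subset: "component G v \<subseteq> verts G"
  by (auto simp: component_def)

lemma component_self: "v \<in> verts G \<Longrightarrow> v \<in> component G v"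
  by (simp add: component_def)

lemma component_step:
  assumes "fin_graph G" "u \<in> component G v" "{u, w} \<in> edges G"
  shows "w \<in> component G v"
  using assms fin_graph_edgeD(2)[OF assms(1,3)]
  by (auto simp: component_def intro: rtranclp.rtrancl_into_rtrancl)

lemma embeds_component:
  assumes "fin_graph G" "embeds h G G'" "v \<in> verts G"
  shows "h ` component G v \<subseteq> component G' (h v)"
proof -
  have "w \<in> verts G \<and> (\<lambda>x y. {x, y} \<in> edges G')\<^sup>*\<^sup>* (h v) (h w)"
    if "(\<lambda>x y. {x, y} \<in> edges G)\<^sup>*\<^sup>* v w" for w
    using that
  proof (induction rule: rtranclp_induct)
    case base
    then show ?case using assms(3) by simp
  next
    case (step y z)
    have "z \<in> verts G" using fin_graph_edgeD[OF assms(1) step.hyps(2)] by blast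
    moreover have "{h y, h z} \<in> edges G'"
      using step calculation assms(2) unfolding embeds_def by blast
    ultimately show ?case using step.IH by (meson rtranclp.rtrancl_into_rtrancl)
  qed
  then show ?thesis using assms(2) unfolding component_def embeds_def by auto
qed

text \<open>An embedding in general sends a component into part of a component. When no edge of
  \<open>G'\<close> leaves the image, a walk from \<open>h v\<close> can be pulled back step by
  step.\<close>

lemma component_of_closed_embedding:
  assumes "fin_graph G" "embeds h G G'" "v \<in> verts G"
    and closed: "\<And>x y. x \<in> verts G \<Longrightarrow> {h x, y} \<in> edges G' \<Longrightarrow> y \<in> h ` verts G"
  shows "component G' (h v) = h ` component G v"
proof
  have "\<exists>w\<in>component G v. z = h w"
    if "(\<lambda>x y. {x, y} \<in> edges G')\<^sup>*\<^sup>* (h v) z" for z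
    using that
  proof (induction rule: rtranclp_induct)
    case base
    then show ?case using component_self[OF assms(3)] by blast
  next
    case (step y z)
    then obtain w where w: "w \<in> component G v" "y = h w" by blast
    have wG: "w \<in> verts G" using w component_subset by blast
    obtain w' where w': "w' \<in> verts G" "z = h w'" using closed[OF wG] step.hyps(2) w(2) by blast
    have "{w, w'} \<in> edges G" using step.hyps(2) w(2) w' wG assms(2) unfolding embeds_def by simp
    then show ?case using component_step[OF assms(1) w(1)] w'(2) by blast
  qed
  then show "component G' (h v) \<subseteq> h ` component G v" unfolding component_def[of G'] by blast
  show "h ` component G v \<subseteq> component G' (h v)" using embeds_component[OF assms(1-3)] .
qed

definition path_or_spider :: "ugraph \<Rightarrow> bool" where
  "path_or_spider K \<longleftrightarrow> (\<exists>r\<ge>1. K \<simeq> Path r) \<or>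
     (\<exists>i j k. 1 \<le> i \<and> i \<le> j \<and> j \<le> k \<and> K \<simeq> S_tree i j k)"

lemma class_S_iff:
  "G \<in> class_S \<longleftrightarrow> fin_graph G \<and> (\<forall>v\<in>verts G. path_or_spider (induced G (component G v)))"
  by (simp add: class_S_def path_or_spider_def)

lemma path_or_spider_iso: "K \<simeq> K' \<Longrightarrow> path_or_spider K \<Longrightarrow> path_or_spider K'"
  unfolding path_or_spider_def by (meson graph_iso_sym graph_iso_trans)

lemma induced_iso_image:
  assumes "embeds h G G'" "W \<subseteq> verts G" shows "induced G W \<simeq> induced G' (h ` W)"
proof -
  have "bij_betw h W (h ` W)"
    using assms unfolding embeds_def by (meson inj_on_imp_bij_betw inj_on_subset)
  moreover have "{u, v} \<in> edges (induced G W) \<longleftrightarrow> {h u, h v} \<in> edges (induced G' (h ` W))"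
    if "u \<in> W" "v \<in> W" for u v
    using subsetD[OF assms(2)] assms(1) that unfolding embeds_def edges_induced by simp
  ultimately show ?thesis unfolding graph_iso_def by auto
qed

text \<open>Serves isomorphic copies and both sides of a disjoint union: in each case no edge leaves
  the image.\<close>

lemma path_or_spider_closed_embedding:
  assumes "G \<in> class_S" "embeds h G G'" "v \<in> verts G"
    and "\<And>x y. x \<in> verts G \<Longrightarrow> {h x, y} \<in> edges G' \<Longrightarrow> y \<in> h ` verts G"
  shows "path_or_spider (induced G' (component G' (h v)))"
proof -
  have "component G' (h v) = h ` component G v"
    using assms by (intro component_of_closed_embedding) (auto simp: class_S_iff)
  then show ?thesis
    using assms(1,3) path_or_spider_iso[OF induced_iso_image[OF assms(2) component_subset]]
    by (simp add: class_S_iff)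
qed

lemma class_S_iso:
  assumes "G \<in> class_S" "fin_graph G'" "G \<simeq> G'" shows "G' \<in> class_S"
proof -
  obtain h where h: "embeds h G G'" "h ` verts G = verts G'"
    using assms(3) unfolding graph_iso_def embeds_def bij_betw_def by blast
  have closed: "y \<in> h ` verts G" if "{h x, y} \<in> edges G'" for x y
    using fin_graph_edgeD(2)[OF assms(2) that] h(2) by simp
  have "path_or_spider (induced G' (component G' w))" if w: "w \<in> verts G'" for w
  proof -
    obtain v where v: "v \<in> verts G" "w = h v" using w h(2) by blast
    show ?thesis unfolding v(2)
      by (rule path_or_spider_closed_embedding[OF assms(1) h(1) v(1) closed])
  qed
  then show ?thesis using assms(2) by (simp add: class_S_iff)
qed

lemma class_S_disj_union:
  assumes G: "G \<in> class_S" and H: "H \<in> class_S" shows "G \<oplus> H \<in> class_S"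
proof -
  have fin: "fin_graph G" "fin_graph H" using assms by (auto simp: class_S_iff)
  have e: "embeds (\<lambda>n. 2 * n) G (G \<oplus> H)"
    unfolding embeds_def verts_disj_union by (auto simp: inj_on_def edges_disj_union(1))
  have o: "embeds (\<lambda>n. 2 * n + 1) H (G \<oplus> H)"
    unfolding embeds_def verts_disj_union edges_disj_union(2) by (auto simp: inj_on_def)
  have fin': "fin_graph (G \<oplus> H)" using fin by (rule fin_graph_disj_union)
  have ce: "y \<in> (\<lambda>n. 2 * n) ` verts G" if "{2 * x, y} \<in> edges (G \<oplus> H)" for x y
    using fin_graph_edgeD(2)[OF fin' that] edges_disj_union(3)[of x _ G H] that
    unfolding verts_disj_union by auto
  have co: "y \<in> (\<lambda>n. 2 * n + 1) ` verts H" if "{2 * x + 1, y} \<in> edges (G \<oplus> H)" for x y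
    using fin_graph_edgeD(2)[OF fin' that] edges_disj_union(4)[of x _ G H] that
    unfolding verts_disj_union by auto
  have "path_or_spider (induced (G \<oplus> H) (component (G \<oplus> H) w))" if w: "w \<in> verts (G \<oplus> H)" for w
  proof -
    consider v where "v \<in> verts G" "w = 2 * v" | v where "v \<in> verts H" "w = 2 * v + 1"
      using w unfolding verts_disj_union by blast
    then show ?thesis
    proof cases
      case 1
      show ?thesis unfolding 1(2) by (rule path_or_spider_closed_embedding[OF G e 1(1) ce])
    next
      case 2
      show ?thesis unfolding 2(2) by (rule path_or_spider_closed_embedding[OF H o 2(1) co])
    qed
  qed
  then show ?thesis using fin' by (simp add: class_S_iff)
qed

lemma class_S_copies: "G \<in> class_S \<Longrightarrow> s \<cdot> G \<in> class_S"
proof (induction s)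
  case 0
  show ?case by (simp add: class_S_iff fin_graph_def)
next
  case (Suc s)
  then show ?case by (simp add: class_S_disj_union)
qed

section \<open>Trees and the degree bounds inside the class\<close>

definition tree_code :: "forest_code \<Rightarrow> bool" where
  "tree_code p \<longleftrightarrow> (\<forall>m<length p. 0 < m \<longrightarrow> (\<exists>j<m. p ! m = Some j))"

text \<open>Parents decrease, so following them joins every vertex to 0.\<close>

lemma component_tree_code:
  assumes "tree_code p" "v < length p"
  shows "component (code_graph p) v = verts (code_graph p)"
proof -
  let ?R = "\<lambda>x y. {x, y} \<in> edges (code_graph p)"
  have sym: "symp ?R" by (auto simp: symp_def insert_commute)
  have "?R\<^sup>*\<^sup>* 0 m" if "m < length p" for m
    using that
  proof (induction m rule: less_induct)
    case (less m)
    show ?case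
    proof (cases "m = 0")
      case False
      then obtain j where j: "j < m" "p ! m = Some j" using assms(1) less.prems by (auto simp: tree_code_def)
      have "?R j m" using j less.prems by (simp add: edges_code_graph code_adj_def)
      moreover have "?R\<^sup>*\<^sup>* 0 j" using less j by simp
      ultimately show ?thesis by (meson rtranclp.rtrancl_into_rtrancl)
    qed simp
  qed
  moreover have "symp ?R\<^sup>*\<^sup>*" using sym by (rule symp_rtranclp)
  ultimately have "?R\<^sup>*\<^sup>* v m" if "m < length p" for m
    using that assms(2) by (meson rtranclp_trans sympD)
  then show ?thesis by (auto simp: component_def)
qed

lemma induced_verts: "fin_graph G \<Longrightarrow> induced G (verts G) = G"
  by (cases G) (auto simp: induced_def fin_graph_def)

lemma tree_code_path: "tree_code (\<pi> r)"
  by (auto simp: tree_code_def code_path_def split: nat.splits)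

lemma tree_code_S: "tree_code (\<sigma> i j k)"
  by (auto simp: tree_code_def code_S_def simp del: upt_Suc split: nat.splits)

lemma class_S_tree_code:
  assumes "tree_code p" "path_or_spider (code_graph p)" shows "code_graph p \<in> class_S"
  using assms unfolding class_S_iff
  by (auto simp: component_tree_code induced_verts[of "code_graph p", simplified])

lemma class_S_Path:
  assumes "r \<ge> 1" shows "Path r \<in> class_S"
proof -
  have "path_or_spider (Path r)" unfolding path_or_spider_def using assms graph_iso_refl by blast
  then show ?thesis unfolding Path_eq by (rule class_S_tree_code[OF tree_code_path])
qed

lemma class_S_S_tree:
  assumes "1 \<le> i" "i \<le> j" "j \<le> k" shows "S_tree i j k \<in> class_S"
proof -
  have eq: "S_tree i j k = code_graph (\<sigma> i j k)" using assms by (intro S_tree_eq) auto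
  have "path_or_spider (S_tree i j k)" unfolding path_or_spider_def using assms graph_iso_refl by blast
  then show ?thesis unfolding eq by (rule class_S_tree_code[OF tree_code_S])
qed

text \<open>One condition for both kinds of component, keeping only the degree bounds: 0 has at most
  three neighbours, and any other vertex has at most its parent and its successor.\<close>

definition spider_code :: "forest_code \<Rightarrow> bool" where
  "spider_code t \<longleftrightarrow> (\<exists>a b c. \<forall>n<length t. t ! n = Some 0 \<longrightarrow> n \<in> {a, b, c}) \<and>
     (\<forall>n<length t. \<forall>m. t ! n = Some m \<longrightarrow> m = 0 \<or> n = Suc m)"

lemma spider_code_path: "spider_code (\<pi> r)"
  by (auto simp: spider_code_def code_path_def split: nat.splits)

lemma spider_code_S: "spider_code (\<sigma> i j k)"
proof -
  have "\<forall>n<length (\<sigma> i j k). \<sigma> i j k ! n = Some 0 \<longrightarrow> n \<in> {1, i + 1, i + j + 1}"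
    by (auto simp: code_S_def simp del: upt_Suc split: nat.splits if_splits)
  moreover have "\<forall>n<length (\<sigma> i j k). \<forall>m. \<sigma> i j k ! n = Some m \<longrightarrow> m = 0 \<or> n = Suc m"
    by (auto simp: code_S_def simp del: upt_Suc split: nat.splits if_splits)
  ultimately show ?thesis unfolding spider_code_def by blast
qed

lemma path_or_spider_imp_code:
  assumes "path_or_spider K" obtains t where "spider_code t" "K \<simeq> code_graph t"
  using assms unfolding path_or_spider_def
proof (elim disjE exE conjE)
  fix r assume "K \<simeq> Path r"
  then show ?thesis using that[of "\<pi> r"] by (simp add: Path_eq spider_code_path)
next
  fix i j k assume "1 \<le> i" "i \<le> j" "j \<le> k" "K \<simeq> S_tree i j k"
  then show ?thesis using that[of "\<sigma> i j k"] S_tree_eq[of i j k] by (simp add: spider_code_S)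
qed

lemma spider_code_three_neighbours:
  assumes "spider_code t" "u < length t" "set ys \<subseteq> {v. v < length t \<and> code_adj t u v}" "distinct ys"
  shows "length ys \<le> 3" "length ys = 3 \<Longrightarrow> u = 0"
proof -
  obtain a b c where root: "\<And>n. n < length t \<Longrightarrow> t ! n = Some 0 \<Longrightarrow> n \<in> {a, b, c}"
    and other: "\<And>n m. n < length t \<Longrightarrow> t ! n = Some m \<Longrightarrow> m = 0 \<or> n = Suc m"
    using assms(1) unfolding spider_code_def by blast
  have len: "length ys = card (set ys)" using assms(4) by (simp add: distinct_card)
  have le2: "length ys \<le> 2" if "u \<noteq> 0"
  proof -
    have "set ys \<subseteq> {the (t ! u), Suc u}"
    proof
      fix v assume "v \<in> set ys"
      then have v: "v < length t" "code_adj t u v" using assms(3) by auto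
      then show "v \<in> {the (t ! u), Suc u}"
        using other[of v u] that by (auto simp: code_adj_def split: if_splits)
    qed
    then have "card (set ys) \<le> card {the (t ! u), Suc u}" by (intro card_mono) auto
    also have "\<dots> \<le> 2" by (simp add: card_insert_if)
    finally show ?thesis using len by simp
  qed
  have le3: "length ys \<le> 3" if "u = 0"
  proof -
    have "set ys \<subseteq> {a, b, c}"
    proof
      fix v assume "v \<in> set ys"
      then have v: "v < length t" "code_adj t u v" using assms(3) by auto
      then show "v \<in> {a, b, c}" using root[of v] that by (auto simp: code_adj_def split: if_splits)
    qed
    then have "card (set ys) \<le> card {a, b, c}" by (intro card_mono) auto
    also have "\<dots> \<le> 3" by (simp add: card_insert_if)
    finally show ?thesis using len by simp
  qed
  show "length ys \<le> 3" using le2 le3 by (cases "u = 0") auto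
  show "u = 0" if "length ys = 3" using le2 that by force
qed

text \<open>A connected graph is mapped into a single component, and that component is a path or a
  subdivided claw.\<close>

lemma class_S_tree_code_sub:
  assumes "G \<in> class_S" "code_graph q \<subseteq>\<^sub>i G" "tree_code q" "q \<noteq> []"
  obtains t where "spider_code t" "code_graph q \<subseteq>\<^sub>i code_graph t"
proof -
  obtain f where f: "embeds f (code_graph q) G" using assms(2) unfolding induced_sub_iff_embeds by blast
  let ?K = "component G (f 0)"
  have "f ` component (code_graph q) 0 \<subseteq> ?K"
    using assms(4) f by (intro embeds_component) auto
  then have K: "f ` verts (code_graph q) \<subseteq> ?K"
    using component_tree_code[OF assms(3)] assms(4) by simp
  have "f 0 \<in> verts G" using f assms(4) unfolding embeds_def by auto
  then obtain t where t: "spider_code t" "induced G ?K \<simeq> code_graph t"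
    using assms(1) path_or_spider_imp_code unfolding class_S_iff by blast
  have "embeds f (code_graph q) (induced G ?K)"
    using f K unfolding embeds_def edges_induced by auto
  then have "code_graph q \<subseteq>\<^sub>i induced G ?K" unfolding induced_sub_iff_embeds by blast
  then show ?thesis using that t induced_sub_iso_right by blast
qed

text \<open>The star with four leaves.\<close>

definition star4_code :: forest_code where
  "star4_code = [None, Some 0, Some 0, Some 0, Some 0]"

text \<open>Two adjacent vertices of degree three, 0 and 1, with leaves 2, 3 and 4, 5.\<close>

definition twin_claw_code :: forest_code where
  "twin_claw_code = [None, Some 0, Some 0, Some 0, Some 1, Some 1]"

lemma embeds_neighbours:
  assumes "embeds g (code_graph q) (code_graph t)" "u < length q"
    "set vs \<subseteq> {v. v < length q \<and> code_adj q u v}" "distinct vs"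
  shows "set (map g vs) \<subseteq> {v. v < length t \<and> code_adj t (g u) v}" "distinct (map g vs)" "g u < length t"
proof -
  have g: "inj_on g {..<length q}" "\<And>v. v < length q \<Longrightarrow> g v < length t"
    "\<And>v. v < length q \<Longrightarrow> code_adj q u v \<Longrightarrow> code_adj t (g u) (g v)"
    using assms(1,2) unfolding embeds_def edges_code_graph by (auto simp: image_subset_iff)
  show "set (map g vs) \<subseteq> {v. v < length t \<and> code_adj t (g u) v}" using g assms(3) by auto
  show "distinct (map g vs)"
    using assms(3,4) inj_on_subset[OF g(1), of "set vs"] by (auto simp: distinct_map)
  show "g u < length t" using g assms(2) by blast
qed

lemma class_S_no_star4:
  assumes "G \<in> class_S" shows "\<not> code_graph star4_code \<subseteq>\<^sub>i G"
proof
  assume "code_graph star4_code \<subseteq>\<^sub>i G"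
  moreover have "tree_code star4_code" by (auto simp: tree_code_def star4_code_def nth_Cons split: nat.splits)
  ultimately obtain t where t: "spider_code t" "code_graph star4_code \<subseteq>\<^sub>i code_graph t"
    using class_S_tree_code_sub[OF assms] by (auto simp: star4_code_def)
  then obtain g where g: "embeds g (code_graph star4_code) (code_graph t)"
    unfolding induced_sub_iff_embeds by blast
  have "set [1, 2, 3, 4] \<subseteq> {v. v < length star4_code \<and> code_adj star4_code 0 v}"
    by (auto simp: star4_code_def code_adj_def)
  from spider_code_three_neighbours(1)[OF t(1) embeds_neighbours(3,1,2)[OF g _ this]]
  show False by (simp add: star4_code_def)
qed

text \<open>Both centres have three neighbours, so both would have to be sent to vertex 0 of the
  component's code.\<close>

lemma class_S_no_twin_claw:
  assumes "G \<in> class_S" shows "\<not> code_graph twin_claw_code \<subseteq>\<^sub>i G"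
proof
  assume "code_graph twin_claw_code \<subseteq>\<^sub>i G"
  moreover have "tree_code twin_claw_code"
    by (auto simp: tree_code_def twin_claw_code_def nth_Cons split: nat.splits)
  ultimately obtain t where t: "spider_code t" "code_graph twin_claw_code \<subseteq>\<^sub>i code_graph t"
    using class_S_tree_code_sub[OF assms] by (auto simp: twin_claw_code_def)
  then obtain g where g: "embeds g (code_graph twin_claw_code) (code_graph t)"
    unfolding induced_sub_iff_embeds by blast
  have "set [1, 2, 3] \<subseteq> {v. v < length twin_claw_code \<and> code_adj twin_claw_code 0 v}"
    by (auto simp: twin_claw_code_def code_adj_def)
  from spider_code_three_neighbours(2)[OF t(1) embeds_neighbours(3,1,2)[OF g _ this]]
  have "g 0 = 0" by (simp add: twin_claw_code_def)
  moreover have "set [0, 4, 5] \<subseteq> {v. v < length twin_claw_code \<and> code_adj twin_claw_code 1 v}"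
    by (auto simp: twin_claw_code_def code_adj_def)
  from spider_code_three_neighbours(2)[OF t(1) embeds_neighbours(3,1,2)[OF g _ this]]
  have "g 1 = 0" by (simp add: twin_claw_code_def)
  moreover have "inj_on g {..<6}" using g by (simp add: embeds_def twin_claw_code_def numeral_eq_Suc)
  ultimately show False using inj_onD[of g "{..<6}" 0 1] by simp
qed

text \<open>Each component is a forest by its code. No edge leaves a component, so a vertex with at
  most one neighbour in the part of \<open>W\<close> inside it has no further neighbour in
  \<open>W\<close>.\<close>

lemma class_S_forest_like:
  assumes "G \<in> class_S" shows "forest_like G"
  unfolding forest_like_def
proof (intro allI impI)
  fix W assume W: "W \<subseteq> verts G" "W \<noteq> {}"
  then obtain w where w: "w \<in> W" "w \<in> verts G" by blast
  let ?K = "component G w"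
  obtain t where "induced G ?K \<simeq> code_graph t"
    using assms w path_or_spider_imp_code unfolding class_S_iff by blast
  then have "forest_like (induced G ?K)"
    using forest_like_code_graph forest_like_induced_sub graph_iso_imp_induced_sub by blast
  moreover have "W \<inter> ?K \<subseteq> verts (induced G ?K)" "W \<inter> ?K \<noteq> {}"
    using w component_self[OF w(2)] by auto
  ultimately have "\<exists>v\<in>W \<inter> ?K. \<exists>x. \<forall>u\<in>W \<inter> ?K. {u, v} \<in> edges (induced G ?K) \<longrightarrow> u = x"
    unfolding forest_like_def by blast
  then obtain v x where v: "v \<in> W" "v \<in> ?K"
    "\<forall>u\<in>W \<inter> ?K. {u, v} \<in> edges (induced G ?K) \<longrightarrow> u = x" by blast
  have "u = x" if "u \<in> W" "{u, v} \<in> edges G" for u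
  proof -
    have "u \<in> ?K"
      using component_step[OF _ v(2)] that(2) assms by (simp add: class_S_iff insert_commute)
    then show ?thesis using v that by (auto simp: edges_induced)
  qed
  then show "\<exists>v\<in>W. \<exists>x. \<forall>u\<in>W. {u, v} \<in> edges G \<longrightarrow> u = x" using v(1) by blast
qed

section \<open>Tables and finite checks\<close>

primrec lazy_ex :: "('a \<Rightarrow> bool) \<Rightarrow> 'a list \<Rightarrow> bool" where
  "lazy_ex P [] = False"
| "lazy_ex P (x # xs) = (if P x then True else lazy_ex P xs)"

lemma lazy_ex_iff: "lazy_ex P xs \<longleftrightarrow> (\<exists>x\<in>set xs. P x)"
  by (induction xs) auto

text \<open>Rules (a3) to (a7).\<close>

definition down_rules :: "(forest_code \<times> forest_code list) list" where
  "down_rules =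
    [(\<pi> 1 \<boxplus> \<pi> 3, [\<sigma> 1 1 1 \<boxplus> 3 \<odot> \<pi> 1, \<sigma> 1 1 1 \<boxplus> \<pi> 2, \<pi> 1 \<boxplus> \<sigma> 1 1 2, \<pi> 6, \<sigma> 1 1 3]),
     (2 \<odot> \<pi> 1 \<boxplus> \<pi> 2, [2 \<odot> \<pi> 1 \<boxplus> \<pi> 3, 3 \<odot> \<pi> 1 \<boxplus> \<pi> 2, \<pi> 2 \<boxplus> \<pi> 3]),
     (\<pi> 1 \<boxplus> \<pi> 4, [\<pi> 1 \<boxplus> \<pi> 4, \<pi> 5]),
     (4 \<odot> \<pi> 1, [2 \<odot> \<pi> 1 \<boxplus> \<pi> 3]),
     (\<sigma> 1 1 1, [\<sigma> 1 1 1])]"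

text \<open>Rules (b3), (b4), (b5) and (b7).\<close>

definition up_rules :: "(forest_code list \<times> forest_code list) list" where
  "up_rules =
    [([\<sigma> 1 1 1, 2 \<odot> \<pi> 2], [4 \<odot> \<pi> 1, 2 \<odot> \<pi> 2]),
     ([\<pi> 1 \<boxplus> \<pi> 4], [\<pi> 2 \<boxplus> \<pi> 4]),
     ([2 \<odot> \<pi> 1 \<boxplus> \<pi> 2], [\<sigma> 1 1 1, 5 \<odot> \<pi> 1, \<pi> 2 \<boxplus> \<pi> 4, \<pi> 6]),
     ([4 \<odot> \<pi> 1], [\<pi> 1 \<boxplus> \<pi> 4, 3 \<odot> \<pi> 1 \<boxplus> \<pi> 2])]"

definition b6_codes :: "forest_code list" where
  "b6_codes = [2 \<odot> \<pi> 1 \<boxplus> 2 \<odot> \<pi> 2, 2 \<odot> \<pi> 1 \<boxplus> \<pi> 4, 4 \<odot> \<pi> 1 \<boxplus> \<pi> 2, 3 \<odot> \<pi> 2, 2 \<odot> \<pi> 3]"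

text \<open>
  The graphs of (b6), reordered so that the search places edges before isolated vertices, and the
  two smallest trees outside \<open>\<S>\<close>; every tree outside \<open>\<S>\<close> contains one of these two or \<open>2P\<^sub>3\<close>.
\<close>

definition obstructions :: "forest_code list" where
  "obstructions = [star4_code, twin_claw_code, \<pi> 4 \<boxplus> 2 \<odot> \<pi> 1, \<pi> 2 \<boxplus> 4 \<odot> \<pi> 1,
     3 \<odot> \<pi> 2, 2 \<odot> \<pi> 3, 2 \<odot> \<pi> 2 \<boxplus> 2 \<odot> \<pi> 1]"

text \<open>The induced subgraphs of P4, which are disposed of by (a1).\<close>

definition small_codes :: "forest_code list" where
  "small_codes = [[], \<pi> 1, 2 \<odot> \<pi> 1, \<pi> 2, \<pi> 1 \<boxplus> \<pi> 2, \<pi> 3, \<pi> 4]"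

text \<open>Ordered by number of vertices. P1+P3 is kept apart because it is traded for 3P1;
  edgeless graphs on five or more vertices form the separate tail.\<close>

definition large_codes :: "forest_code list" where
  "large_codes = [3 \<odot> \<pi> 1, 4 \<odot> \<pi> 1, 2 \<odot> \<pi> 1 \<boxplus> \<pi> 2, 2 \<odot> \<pi> 2, \<sigma> 1 1 1,
     3 \<odot> \<pi> 1 \<boxplus> \<pi> 2, 2 \<odot> \<pi> 1 \<boxplus> \<pi> 3, \<pi> 1 \<boxplus> 2 \<odot> \<pi> 2, \<pi> 1 \<boxplus> \<sigma> 1 1 1, \<pi> 1 \<boxplus> \<pi> 4, \<pi> 2 \<boxplus> \<pi> 3,
     \<sigma> 1 1 2, \<pi> 5, 3 \<odot> \<pi> 1 \<boxplus> \<pi> 3, 2 \<odot> \<pi> 1 \<boxplus> \<sigma> 1 1 1, \<pi> 1 \<boxplus> \<pi> 2 \<boxplus> \<pi> 3, \<pi> 1 \<boxplus> \<sigma> 1 1 2,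
     \<pi> 2 \<boxplus> \<sigma> 1 1 1, \<pi> 1 \<boxplus> \<pi> 5, \<pi> 2 \<boxplus> \<pi> 4, \<sigma> 1 2 2, \<sigma> 1 1 3, \<pi> 6,
     3 \<odot> \<pi> 1 \<boxplus> \<sigma> 1 1 1, \<pi> 1 \<boxplus> \<sigma> 1 1 3, \<sigma> 1 2 3]"

definition catalogue :: "forest_code list" where
  "catalogue = small_codes @ (\<pi> 1 \<boxplus> \<pi> 3) # large_codes"

definition listed_codes :: "(forest_code \<times> forest_code) list" where
  "listed_codes =
    map (Pair (3 \<odot> \<pi> 1)) [\<pi> 1 \<boxplus> \<pi> 2 \<boxplus> \<pi> 3, \<pi> 1 \<boxplus> 2 \<odot> \<pi> 2, \<pi> 1 \<boxplus> \<pi> 5, \<pi> 1 \<boxplus> \<sigma> 1 1 3,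
      \<pi> 2 \<boxplus> \<pi> 4, \<sigma> 1 2 2, \<sigma> 1 2 3] @
    map (Pair (2 \<odot> \<pi> 1 \<boxplus> \<pi> 2)) [\<pi> 1 \<boxplus> \<pi> 2 \<boxplus> \<pi> 3, \<pi> 1 \<boxplus> 2 \<odot> \<pi> 2, \<pi> 1 \<boxplus> \<pi> 5] @
    map (Pair (\<pi> 1 \<boxplus> \<pi> 4)) [\<pi> 1 \<boxplus> 2 \<odot> \<pi> 2, \<pi> 2 \<boxplus> \<pi> 3] @
    [(2 \<odot> \<pi> 1 \<boxplus> \<pi> 3, 2 \<odot> \<pi> 1 \<boxplus> \<pi> 3)]"

text \<open>Coordinates are \<open>H1\<close> and \<open>co H2\<close>, so complementing and
  exchanging both graphs is \<open>prod.swap\<close>. Replacing 3P1 by P1+P3 on the left suffices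
  before swapping, since 3P1 is never a second entry of \<open>listed_codes\<close>. Closure under
  \<open>prod.swap\<close> later lets checks of one coordinate or one order cover both.\<close>

definition orbit_codes :: "(forest_code \<times> forest_code) list" where
  "orbit_codes = (let ps = listed_codes @ map (\<lambda>(a, b). (\<pi> 1 \<boxplus> \<pi> 3, b))
       (filter (\<lambda>(a, b). a = 3 \<odot> \<pi> 1) listed_codes)
     in ps @ map prod.swap ps)"

text \<open>Profiles record which rules a graph can enter, so that the search runs once per graph, not once per pair.\<close>

definition left_profile :: "forest_code \<Rightarrow> bool list" where
  "left_profile p = map (\<lambda>(X, Ys). code_sub p X) down_rules @
     map (\<lambda>(Xs, Ys). list_ex (\<lambda>X. code_sub X p) Xs) up_rules"

definition right_profile :: "forest_code \<Rightarrow> bool list" where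
  "right_profile p = map (\<lambda>(X, Ys). list_ex (code_sub p) Ys) down_rules @
     map (\<lambda>(Xs, Ys). list_ex (\<lambda>Y. code_sub Y p) Ys) up_rules"

definition profiles_match :: "bool list \<Rightarrow> bool list \<Rightarrow> bool" where
  "profiles_match l r \<longleftrightarrow> list_ex (\<lambda>(x, y). x \<and> y) (zip l r)"

definition profiled :: "forest_code \<Rightarrow> forest_code \<times> bool list \<times> bool list" where
  "profiled p = (p, left_profile p, right_profile p)"

section \<open>Growth by one vertex and the finite checks\<close>

definition edgeless_code :: "forest_code \<Rightarrow> bool" where
  "edgeless_code p \<longleftrightarrow> list_all (\<lambda>c. c = None) p"

text \<open>The number of edges when all entries point to smaller vertices; a cheap filter before
  the search.\<close>

definition code_size :: "forest_code \<Rightarrow> nat" where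
  "code_size p = length (filter (\<lambda>c. c \<noteq> None) p)"

definition in_catalogue :: "forest_code \<Rightarrow> bool" where
  "in_catalogue q = lazy_ex (\<lambda>p. if length q = length p then
     if code_size q = code_size p then code_sub q p else False else False) catalogue"

definition extension_ok :: "forest_code \<Rightarrow> bool" where
  "extension_ok q = (if edgeless_code q then True else if in_catalogue q then True
     else lazy_ex (\<lambda>X. code_sub X q) obstructions)"

text \<open>The induction step of the classification as a computation. Edgeless results pass because
  4P1 grows into 5P1, which leaves the table without meeting an obstruction.\<close>

lemma catalogue_extensions:
  "\<forall>p\<in>set catalogue. \<forall>c\<in>set (None # map Some [0..<length p]). extension_ok (p @ [c])"
  by code_simp

text \<open>Both orders of the coordinates are tried, and two edgeless graphs fall under (a2). Rules
  (a1), (b1), (b2) and (b6) do not appear: they have been spent on reaching this table.\<close>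

lemma large_pairs:
  "\<forall>(a, l, r)\<in>set (map profiled large_codes). \<forall>(b, l', r')\<in>set (map profiled large_codes).
     profiles_match l r' \<or> profiles_match l' r \<or> edgeless_code a \<and> edgeless_code b \<or>
     (a, b) \<in> set listed_codes \<or> (b, a) \<in> set listed_codes"
  by code_simp

lemma orbit_profiles:
  "\<forall>(a, b)\<in>set orbit_codes. \<not> profiles_match (left_profile a) (right_profile b)"
  by code_simp

lemma orbit_b6_free:
  "\<forall>b\<in>set (remdups (map snd orbit_codes)). \<forall>Y\<in>set b6_codes. \<not> code_sub Y b"
  by code_simp

text \<open>Handles the infinite tail: \<open>up_rules\<close> ask only for containment, and every
  sP1 with s at least 5 contains 5P1.\<close>

lemma five_isolated_pairs:
  "\<forall>b\<in>set large_codes. edgeless_code b \<or>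
     (\<exists>(Xs, Ys)\<in>set up_rules. (\<exists>X\<in>set Xs. code_sub X b) \<and> (\<exists>Y\<in>set Ys. code_sub Y (5 \<odot> \<pi> 1)))"
  by code_simp

lemma small_codes_sub: "\<forall>p\<in>set small_codes. code_sub p (\<pi> 4)"
  by code_simp

lemma large_codes_super:
  "\<forall>p\<in>set ((\<pi> 1 \<boxplus> \<pi> 3) # large_codes). code_sub (3 \<odot> \<pi> 1) p \<or> code_sub (2 \<odot> \<pi> 2) p"
  by code_simp

text \<open>Reordering vertices changes codes, so the link with \<open>b6_codes\<close> is
  containment instead of equality, which is enough for freeness.\<close>

lemma obstructions_cases:
  "\<forall>X\<in>set obstructions. X = star4_code \<or> X = twin_claw_code \<or> (\<exists>Y\<in>set b6_codes. code_sub Y X)"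
  by code_simp

text \<open>The first part makes every graph without 3P1 free of the (b6) graphs; the second is what
  (b3) asks of \<open>co H2\<close>.\<close>

lemma b6_codes_super:
  "\<forall>Y\<in>set b6_codes. code_sub (3 \<odot> \<pi> 1) Y \<and> (code_sub (4 \<odot> \<pi> 1) Y \<or> code_sub (2 \<odot> \<pi> 2) Y)"
  by code_simp

text \<open>The complement of a forest contains neither 3P1 nor 2P2, so it can never enter one of
  these rules on the left.\<close>

lemma up_rules_super:
  "\<forall>(Xs, Ys)\<in>set up_rules. \<forall>X\<in>set Xs. code_sub (3 \<odot> \<pi> 1) X \<or> code_sub (2 \<odot> \<pi> 2) X"
  by code_simp

lemma orbit_super_3P1: "\<forall>(a, b)\<in>set orbit_codes. code_sub (3 \<odot> \<pi> 1) a"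
  by code_simp

lemma orbit_not_sub_P4: "\<forall>(a, b)\<in>set orbit_codes. \<not> code_sub a (\<pi> 4)"
  by code_simp

lemma orbit_has_edge: "\<forall>(a, b)\<in>set orbit_codes. code_sub (\<pi> 2) a \<or> code_sub (\<pi> 2) b"
  by code_simp

text \<open>Isomorphism is tested by containment both ways. The second coordinate is the one needed,
  since K3 as second graph of a pair shows up there as its complement 3P1.\<close>

lemma orbit_exchange:
  "\<forall>(a, b)\<in>set orbit_codes.
     (code_sub (3 \<odot> \<pi> 1) b \<and> code_sub b (3 \<odot> \<pi> 1) \<longrightarrow> (a, \<pi> 1 \<boxplus> \<pi> 3) \<in> set orbit_codes) \<and>
     (code_sub (\<pi> 1 \<boxplus> \<pi> 3) b \<and> code_sub b (\<pi> 1 \<boxplus> \<pi> 3) \<longrightarrow> (a, 3 \<odot> \<pi> 1) \<in> set orbit_codes)"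
  by code_simp

lemma few_isolated_in_catalogue: "\<forall>s\<in>set [0..<5]. replicate s None \<in> set catalogue"
  by code_simp

section \<open>Forests without the graphs of (b6)\<close>

text \<open>A vertex with at most one neighbour can be numbered last, with that neighbour as parent
  or \<open>None\<close> if there is none. This makes parent lists fit for growing forests by one
  vertex.\<close>

lemma add_leaf_iso:
  assumes fin: "fin_graph G" and v: "v \<in> verts G"
    and iso: "induced G (verts G - {v}) \<simeq> code_graph p"
    and leaf: "\<And>u. u \<in> verts G \<Longrightarrow> {u, v} \<in> edges G \<Longrightarrow> u = x"
  shows "\<exists>c\<in>set (None # map Some [0..<length p]). G \<simeq> code_graph (p @ [c])"
proof -
  let ?V = "verts G - {v}"
  obtain f where f: "bij_betw f ?V {..<length p}"
    and fe: "\<And>u w. u \<in> ?V \<Longrightarrow> w \<in> ?V \<Longrightarrow> {u, w} \<in> edges G \<longleftrightarrow> {f u, f w} \<in> edges (code_graph p)"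
    using iso unfolding graph_iso_def by (auto simp: edges_induced)
  have less: "f u < length p" if "u \<in> ?V" for u using bij_betwE[OF f] that by blast
  define c where "c = (if {x, v} \<in> edges G then Some (f x) else None)"
  have x: "x \<in> ?V" if "{x, v} \<in> edges G" using fin_graph_edgeD[OF fin that] by blast
  have c: "c \<in> set (None # map Some [0..<length p])" using less x by (auto simp: c_def)
  have c_iff: "c = Some (f u) \<longleftrightarrow> {u, v} \<in> edges G" if "u \<in> ?V" for u
  proof
    assume "c = Some (f u)"
    then have "{x, v} \<in> edges G" "f u = f x" by (auto simp: c_def split: if_splits)
    then show "{u, v} \<in> edges G" using inj_onD[OF bij_betw_imp_inj_on[OF f], of u x] x that by simp
  next
    assume "{u, v} \<in> edges G"
    then show "c = Some (f u)" using leaf[of u] that by (simp add: c_def)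
  qed
  let ?g = "f(v := length p)"
  have "bij_betw ?g ?V {..<length p}" using f by (subst bij_betw_cong[of _ ?g f]) auto
  then have "bij_betw ?g (?V \<union> {v}) ({..<length p} \<union> {?g v})"
    by (intro notIn_Un_bij_betw) auto
  moreover have "?V \<union> {v} = verts G" using v by blast
  moreover have "{..<length p} \<union> {?g v} = verts (code_graph (p @ [c]))" by auto
  ultimately have bij: "bij_betw ?g (verts G) (verts (code_graph (p @ [c])))" by simp
  have "{u, w} \<in> edges G \<longleftrightarrow> {?g u, ?g w} \<in> edges (code_graph (p @ [c]))"
    if "u \<in> verts G" "w \<in> verts G" for u w
  proof -
    consider "u \<in> ?V" "w \<in> ?V" | "u = v" "w \<in> ?V" | "u \<in> ?V" "w = v" | "u = v" "w = v"
      using \<open>u \<in> verts G\<close> \<open>w \<in> verts G\<close> by blast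
    then show ?thesis
    proof cases
      case 1
      then show ?thesis using fe[of u w] less[of u] less[of w] by (auto simp: edges_code_graph code_adj_def nth_append)
    next
      case 2
      then show ?thesis using c_iff[of w] less[of w]
        by (auto simp: edges_code_graph code_adj_def nth_append insert_commute)
    next
      case 3
      then show ?thesis using c_iff[of u] less[of u]
        by (auto simp: edges_code_graph code_adj_def nth_append)
    next
      case 4
      then show ?thesis using fin_graph_edgeD(3)[OF fin, of v v]
          fin_graph_edgeD(3)[OF fin_graph_code_graph, of "length p" "length p" "p @ [c]"] by auto
    qed
  qed
  then show ?thesis using bij c unfolding graph_iso_def by blast
qed

lemma edgeless_code_iff: "edgeless_code p \<longleftrightarrow> p = replicate (length p) None"
  unfolding edgeless_code_def list_all_iff by (metis in_set_replicate replicate_eqI)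

lemma replicate_mono: "s \<le> t \<Longrightarrow> code_graph (replicate s None) \<subseteq>\<^sub>i code_graph (replicate t None)"
  unfolding induced_sub_iff_embeds
  by (rule exI[of _ id]) (auto simp: embeds_def edges_code_graph code_adj_def)

lemma isolated_code: "s \<odot> \<pi> 1 = replicate s None"
  by (induction s) (simp_all add: code_union_def code_path_def)

text \<open>One of the \<open>s\<close> isolated vertices receives the edge and at least four stay
  isolated; so attaching a leaf never leads out of the tail without creating an obstruction.\<close>

lemma isolated_plus_edge:
  assumes "s \<ge> 5" "j < s"
  shows "code_graph (\<pi> 2 \<boxplus> 4 \<odot> \<pi> 1) \<subseteq>\<^sub>i code_graph (replicate s None @ [Some j])"
proof -
  have code: "\<pi> 2 \<boxplus> 4 \<odot> \<pi> 1 = [None, Some 0, None, None, None, None]" by code_simp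
  have adj: "code_adj (replicate s None @ [Some j]) u v \<longleftrightarrow> u = j \<and> v = s \<or> u = s \<and> v = j"
    if "u \<le> s" "v \<le> s" for u v
    using that assms by (auto simp: code_adj_def nth_append)
  have adj': "code_adj [None, Some 0, None, None, None, None] u v \<longleftrightarrow> u = 0 \<and> v = 1 \<or> u = 1 \<and> v = 0"
    if "u < 6" "v < 6" for u v
    using that by (auto simp: code_adj_def nth_Cons split: nat.splits)
  \<comment> \<open>0 and 1 go to the ends \<open>j\<close> and \<open>s\<close> of the edge; 2 to 5
    go in order to the members of 0 to 4, skipping \<open>j\<close>.\<close>
  define f where "f k = (if k = 0 then j else if k = 1 then s else if k - 2 < j then k - 2 else k - 1)" for k
  have le: "f k \<le> s" if "k < 6" for k using that assms by (auto simp: f_def)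
  have inj: "inj_on f {..<6}" using assms by (auto simp: inj_on_def f_def split: if_splits)
  have "f 0 = j" "f 1 = s" by (auto simp: f_def)
  then have j: "f k = j \<longleftrightarrow> k = 0" and s: "f k = s \<longleftrightarrow> k = 1" if "k < 6" for k
    using inj_onD[OF inj, of k 0] inj_onD[OF inj, of k 1] that by auto
  have "embeds f (code_graph [None, Some 0, None, None, None, None]) (code_graph (replicate s None @ [Some j]))"
    unfolding embeds_def
  proof (intro conjI ballI)
    fix u v assume "u \<in> verts (code_graph [None, Some 0, None, None, None, None])"
      "v \<in> verts (code_graph [None, Some 0, None, None, None, None])"
    then have "u < 6" "v < 6" by auto
    then show "{u, v} \<in> edges (code_graph [None, Some 0, None, None, None, None]) \<longleftrightarrow>
        {f u, f v} \<in> edges (code_graph (replicate s None @ [Some j]))"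
      using le[of u] le[of v] by (simp add: edges_code_graph adj adj' j s less_Suc_eq_le)
  qed (use inj le in \<open>auto simp: less_Suc_eq_le numeral_eq_Suc\<close>)
  then show ?thesis unfolding induced_sub_iff_embeds code by blast
qed

definition catalogued :: "forest_code \<Rightarrow> bool" where
  "catalogued p \<longleftrightarrow> p \<in> set catalogue \<or> (\<exists>s\<ge>5. p = replicate s None)"

lemma extension_catalogued:
  assumes "catalogued p" "c \<in> set (None # map Some [0..<length p])"
  shows "(\<exists>q. catalogued q \<and> code_graph (p @ [c]) \<simeq> code_graph q) \<or>
    (\<exists>X\<in>set obstructions. code_graph X \<subseteq>\<^sub>i code_graph (p @ [c]))"
proof -
  have edgeless: "catalogued (replicate n None)" for n
    using few_isolated_in_catalogue by (cases "n < 5") (auto simp: catalogued_def)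
  show ?thesis
  proof (cases "p \<in> set catalogue")
    case True
    then have "extension_ok (p @ [c])" using catalogue_extensions assms(2) by blast
    then consider "edgeless_code (p @ [c])" | "in_catalogue (p @ [c])"
      | "\<exists>X\<in>set obstructions. code_sub X (p @ [c])"
      unfolding extension_ok_def lazy_ex_iff by (auto split: if_splits)
    then show ?thesis
    proof cases
      case 1
      then show ?thesis using edgeless graph_iso_refl unfolding edgeless_code_iff by metis
    next
      case 2
      then obtain q where "q \<in> set catalogue" "length (p @ [c]) = length q" "code_sub (p @ [c]) q"
        unfolding in_catalogue_def lazy_ex_iff by (auto split: if_splits)
      then show ?thesis using code_graph_iso[of "p @ [c]" q] unfolding catalogued_def by blast
    next
      case 3
      then show ?thesis unfolding code_sub_iff by blast
    qed
  next
    case False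
    then obtain s where s: "s \<ge> 5" "p = replicate s None" using assms(1) unfolding catalogued_def by blast
    show ?thesis
    proof (cases c)
      case None
      then have "p @ [c] = replicate (Suc s) None" using s(2) by (simp add: replicate_append_same)
      then show ?thesis using edgeless graph_iso_refl by metis
    next
      case (Some j)
      then have "j < s" using assms(2) s(2) by auto
      then have "code_graph (\<pi> 2 \<boxplus> 4 \<odot> \<pi> 1) \<subseteq>\<^sub>i code_graph (p @ [c])"
        using isolated_plus_edge[OF s(1)] Some s(2) by simp
      moreover have "\<pi> 2 \<boxplus> 4 \<odot> \<pi> 1 \<in> set obstructions" by (simp add: obstructions_def)
      ultimately show ?thesis by blast
    qed
  qed
qed

text \<open>The induction runs over forests without obstructions, not over \<open>class_S\<close>:
  both properties pass to induced subgraphs at once, while deleting a vertex in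
  \<open>class_S\<close> would require a study of how components split. The two trees among the
  obstructions stand in for \<open>class_S\<close>.\<close>

lemma forest_like_catalogued:
  assumes "fin_graph G" "forest_like G" "\<And>X. X \<in> set obstructions \<Longrightarrow> \<not> code_graph X \<subseteq>\<^sub>i G"
  shows "\<exists>p. catalogued p \<and> G \<simeq> code_graph p"
  using assms
proof (induction "card (verts G)" arbitrary: G)
  case 0
  then have "verts G = {}" by (simp add: fin_graph_def)
  then have "G \<simeq> code_graph []" unfolding graph_iso_def by (auto simp: bij_betw_def)
  moreover have "catalogued []" by (simp add: catalogued_def catalogue_def small_codes_def)
  ultimately show ?case by blast
next
  case (Suc n)
  have "verts G \<noteq> {}" using Suc.hyps(2) by auto
  then have "\<exists>v\<in>verts G. \<exists>x. \<forall>u\<in>verts G. {u, v} \<in> edges G \<longrightarrow> u = x"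
    using Suc.prems(2) unfolding forest_like_def by blast
  then obtain v x where v: "v \<in> verts G" "\<And>u. u \<in> verts G \<Longrightarrow> {u, v} \<in> edges G \<Longrightarrow> u = x" by blast
  let ?G' = "induced G (verts G - {v})"
  have sub: "?G' \<subseteq>\<^sub>i G" by (simp add: induced_induced_sub)
  have "\<exists>p. catalogued p \<and> ?G' \<simeq> code_graph p"
  proof (rule Suc.hyps(1))
    show "n = card (verts ?G')" using Suc.hyps(2) v(1) by simp
    show "fin_graph ?G'" using Suc.prems(1) by (simp add: fin_graph_induced)
    show "forest_like ?G'" using forest_like_induced_sub[OF Suc.prems(2) sub] .
    show "\<not> code_graph X \<subseteq>\<^sub>i ?G'" if "X \<in> set obstructions" for X
      using Suc.prems(3)[OF that] induced_sub_trans[OF _ sub] by blast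
  qed
  then obtain p where p: "catalogued p" "?G' \<simeq> code_graph p" by blast
  obtain c where c: "c \<in> set (None # map Some [0..<length p])" "G \<simeq> code_graph (p @ [c])"
    using add_leaf_iso[OF Suc.prems(1) v(1) p(2) v(2)] by blast
  from extension_catalogued[OF p(1) c(1)] show ?case
  proof
    assume "\<exists>q. catalogued q \<and> code_graph (p @ [c]) \<simeq> code_graph q"
    then show ?thesis using c(2) graph_iso_trans by blast
  next
    assume "\<exists>X\<in>set obstructions. code_graph X \<subseteq>\<^sub>i code_graph (p @ [c])"
    then show ?thesis using Suc.prems(3) induced_sub_iso_right[OF c(2)] by blast
  qed
qed

definition b6_free :: "ugraph \<Rightarrow> bool" where
  "b6_free G \<longleftrightarrow> (\<forall>Y\<in>set b6_codes. \<not> code_graph Y \<subseteq>\<^sub>i G)"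

lemma class_S_catalogued:
  assumes "G \<in> class_S" "b6_free G" shows "\<exists>p. catalogued p \<and> G \<simeq> code_graph p"
proof (rule forest_like_catalogued)
  show "fin_graph G" using assms(1) by (simp add: class_S_iff)
  show "forest_like G" using assms(1) by (rule class_S_forest_like)
  fix X assume "X \<in> set obstructions"
  then consider "X = star4_code" | "X = twin_claw_code" | Y where "Y \<in> set b6_codes" "code_sub Y X"
    using obstructions_cases by blast
  then show "\<not> code_graph X \<subseteq>\<^sub>i G"
  proof cases
    case 1
    then show ?thesis using class_S_no_star4[OF assms(1)] by simp
  next
    case 2
    then show ?thesis using class_S_no_twin_claw[OF assms(1)] by simp
  next
    case 3
    then show ?thesis using assms(2) induced_sub_trans unfolding b6_free_def code_sub_iff[symmetric] by blast
  qed
qed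

lemma b6_free_if_no_3P1: "\<not> code_graph (3 \<odot> \<pi> 1) \<subseteq>\<^sub>i G \<Longrightarrow> b6_free G"
  unfolding b6_free_def
  using b6_codes_super unfolding code_sub_iff[symmetric] by (blast dest: induced_sub_trans)

lemma large_edgeless_super:
  "s \<ge> 5 \<Longrightarrow> t \<le> 5 \<Longrightarrow> code_graph (t \<odot> \<pi> 1) \<subseteq>\<^sub>i code_graph (replicate s None)"
  unfolding isolated_code by (rule replicate_mono) simp

text \<open>Used twice: a graph outside P4 without 3P1 contains 2P2, as (b3) requires, and a graph
  avoiding both 3P1 and 2P2 lies in P4. The tail contains 3P1, so only the table is checked.\<close>

lemma catalogued_small_or_super:
  assumes "catalogued p" "\<not> code_graph (3 \<odot> \<pi> 1) \<subseteq>\<^sub>i code_graph p"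
  shows "code_graph p \<subseteq>\<^sub>i code_graph (\<pi> 4) \<or> code_graph (2 \<odot> \<pi> 2) \<subseteq>\<^sub>i code_graph p"
proof (cases "p \<in> set catalogue")
  case True
  then have "p \<in> set small_codes \<or> p \<in> set ((\<pi> 1 \<boxplus> \<pi> 3) # large_codes)" by (auto simp: catalogue_def)
  then show ?thesis using small_codes_sub large_codes_super assms(2) unfolding code_sub_iff by blast
next
  case False
  then show ?thesis using assms large_edgeless_super[of _ 3] unfolding catalogued_def by auto
qed

section \<open>Complements that are not forests\<close>

definition two_non_neighbours :: "forest_code \<Rightarrow> bool" where
  "two_non_neighbours X \<longleftrightarrow> (\<forall>v\<in>set [0..<length X]. \<exists>u\<in>set [0..<length X]. \<exists>w\<in>set [0..<length X].
     u \<noteq> w \<and> u \<noteq> v \<and> w \<noteq> v \<and> \<not> code_adj X u v \<and> \<not> code_adj X w v)"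

lemma two_non_neighbours: "two_non_neighbours (3 \<odot> \<pi> 1)" "two_non_neighbours (2 \<odot> \<pi> 2)"
  by code_simp+

text \<open>In the complement every vertex has two neighbours, so the whole vertex set violates
  \<open>forest_like\<close>. The two instances in use are the triangle and the four-cycle.\<close>

lemma two_non_neighbours_not_forest_like:
  assumes "two_non_neighbours X" "X \<noteq> []" shows "\<not> forest_like (co (code_graph X))"
proof
  assume "forest_like (co (code_graph X))"
  from this[unfolded forest_like_def, THEN spec, of "{..<length X}"]
  obtain v x where v: "v < length X"
    and x: "\<And>u. u < length X \<Longrightarrow> {u, v} \<in> edges (co (code_graph X)) \<Longrightarrow> u = x"
    using assms(2) by (auto simp: lessThan_empty_iff)
  have "v \<in> set [0..<length X]" using v by simp
  from bspec[OF assms(1)[unfolded two_non_neighbours_def] this]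
  obtain u w where "u < length X" "w < length X" "u \<noteq> w" "u \<noteq> v" "w \<noteq> v"
    "\<not> code_adj X u v" "\<not> code_adj X w v" by auto
  then show False using x[of u] x[of w] v by (simp add: edges_co edges_code_graph)
qed

lemma co_not_forest_like:
  assumes "forest_like G" "fin_graph H"
    and "code_graph (3 \<odot> \<pi> 1) \<subseteq>\<^sub>i H \<or> code_graph (2 \<odot> \<pi> 2) \<subseteq>\<^sub>i H"
  shows "\<not> co H \<subseteq>\<^sub>i G"
proof
  assume "co H \<subseteq>\<^sub>i G"
  then have H: "forest_like (co H)" using assms(1) forest_like_induced_sub by blast
  have "3 \<odot> \<pi> 1 \<noteq> []" "2 \<odot> \<pi> 2 \<noteq> []" by code_simp+
  then have "\<not> forest_like (co (code_graph (3 \<odot> \<pi> 1)))" "\<not> forest_like (co (code_graph (2 \<odot> \<pi> 2)))"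
    using two_non_neighbours_not_forest_like two_non_neighbours by blast+
  moreover have "forest_like (co (code_graph X))" if "code_graph X \<subseteq>\<^sub>i H" for X
    using forest_like_induced_sub[OF H co_mono[OF fin_graph_code_graph assms(2) that]] .
  ultimately show False using assms(3) by blast
qed

text \<open>As both graphs are forests, \<open>G\<close> avoids 3P1 and 2P2. Avoiding 3P1 brings it
  into the catalogue, where only the subgraphs of P4 avoid both.\<close>

lemma class_S_and_co:
  assumes "G \<in> class_S" "co G \<in> class_S" shows "G \<subseteq>\<^sub>i code_graph (\<pi> 4)"
proof -
  have fin: "fin_graph G" using assms(1) by (simp add: class_S_iff)
  have no: "\<not> code_graph (3 \<odot> \<pi> 1) \<subseteq>\<^sub>i G" "\<not> code_graph (2 \<odot> \<pi> 2) \<subseteq>\<^sub>i G"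
    using co_not_forest_like[OF class_S_forest_like[OF assms(2)] fin] induced_sub_refl by blast+
  obtain p where p: "catalogued p" "G \<simeq> code_graph p"
    using class_S_catalogued[OF assms(1) b6_free_if_no_3P1[OF no(1)]] by blast
  then show ?thesis
    using catalogued_small_or_super[OF p(1)] no
    unfolding induced_sub_iso_left[OF p(2)] induced_sub_iso_right[OF p(2)] by blast
qed

section \<open>Settled and listed pairs in terms of codes\<close>

lemma represents_code: "represents p (code_graph p)"
  by (simp add: represents_def graph_iso_refl)

lemma represents_sub: "represents p G \<Longrightarrow> X \<subseteq>\<^sub>i G \<longleftrightarrow> X \<subseteq>\<^sub>i code_graph p"
  unfolding represents_def using induced_sub_iso_right by blast

lemma represents_super: "represents p G \<Longrightarrow> G \<subseteq>\<^sub>i X \<longleftrightarrow> code_graph p \<subseteq>\<^sub>i X"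
  unfolding represents_def using induced_sub_iso_left by blast

lemma represents_iso: "represents p G \<Longrightarrow> X \<simeq> G \<longleftrightarrow> X \<simeq> code_graph p"
  unfolding represents_def using graph_iso_cong_right by blast

lemma named_graphs:
  "represents (\<pi> 4) (Path 4)" "represents (\<pi> 5) (Path 5)" "represents (\<pi> 6) (Path 6)"
  "represents (\<pi> 1 \<boxplus> \<pi> 3) (Path 1 \<oplus> Path 3)"
  "represents (\<sigma> 1 1 1 \<boxplus> 3 \<odot> \<pi> 1) (Claw \<oplus> 3 \<cdot> Path 1)"
  "represents (\<sigma> 1 1 1 \<boxplus> \<pi> 2) (Claw \<oplus> Path 2)"
  "represents (\<pi> 1 \<boxplus> \<sigma> 1 1 2) (Path 1 \<oplus> S_tree 1 1 2)"
  "represents (\<pi> 1 \<boxplus> \<sigma> 1 1 3) (Path 1 \<oplus> S_tree 1 1 3)"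
  "represents (\<sigma> 1 1 3) (S_tree 1 1 3)" "represents (\<sigma> 1 2 2) (S_tree 1 2 2)" "represents (\<sigma> 1 2 3) (S_tree 1 2 3)"
  "represents (2 \<odot> \<pi> 1 \<boxplus> \<pi> 2) (2 \<cdot> Path 1 \<oplus> Path 2)"
  "represents (2 \<odot> \<pi> 1 \<boxplus> \<pi> 3) (2 \<cdot> Path 1 \<oplus> Path 3)"
  "represents (3 \<odot> \<pi> 1 \<boxplus> \<pi> 2) (3 \<cdot> Path 1 \<oplus> Path 2)"
  "represents (\<pi> 2 \<boxplus> \<pi> 3) (Path 2 \<oplus> Path 3)"
  "represents (\<pi> 1 \<boxplus> \<pi> 4) (Path 1 \<oplus> Path 4)"
  "represents (\<pi> 1 \<boxplus> \<pi> 5) (Path 1 \<oplus> Path 5)"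
  "represents (\<pi> 2 \<boxplus> \<pi> 4) (Path 2 \<oplus> Path 4)"
  "represents (\<pi> 1 \<boxplus> \<pi> 2 \<boxplus> \<pi> 3) (Path 1 \<oplus> Path 2 \<oplus> Path 3)"
  "represents (\<pi> 1 \<boxplus> 2 \<odot> \<pi> 2) (Path 1 \<oplus> 2 \<cdot> Path 2)"
  "represents (3 \<odot> \<pi> 1) (3 \<cdot> Path 1)" "represents (4 \<odot> \<pi> 1) (4 \<cdot> Path 1)" "represents (5 \<odot> \<pi> 1) (5 \<cdot> Path 1)"
  "represents (2 \<odot> \<pi> 2) (2 \<cdot> Path 2)" "represents (3 \<odot> \<pi> 2) (3 \<cdot> Path 2)" "represents (2 \<odot> \<pi> 3) (2 \<cdot> Path 3)"
  "represents (\<sigma> 1 1 1) Claw"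
  "represents (2 \<odot> \<pi> 1 \<boxplus> 2 \<odot> \<pi> 2) (2 \<cdot> Path 1 \<oplus> 2 \<cdot> Path 2)"
  "represents (2 \<odot> \<pi> 1 \<boxplus> \<pi> 4) (2 \<cdot> Path 1 \<oplus> Path 4)"
  "represents (4 \<odot> \<pi> 1 \<boxplus> \<pi> 2) (4 \<cdot> Path 1 \<oplus> Path 2)"
  by (intro represents_intros; simp)+

definition down_settled :: "ugraph \<Rightarrow> ugraph \<Rightarrow> bool" where
  "down_settled A B \<longleftrightarrow> (\<exists>(X, Ys)\<in>set down_rules. A \<subseteq>\<^sub>i code_graph X \<and> (\<exists>Y\<in>set Ys. B \<subseteq>\<^sub>i code_graph Y))"

definition up_settled :: "ugraph \<Rightarrow> ugraph \<Rightarrow> bool" where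
  "up_settled A B \<longleftrightarrow> (\<exists>(Xs, Ys)\<in>set up_rules.
     (\<exists>X\<in>set Xs. code_graph X \<subseteq>\<^sub>i A) \<and> (\<exists>Y\<in>set Ys. code_graph Y \<subseteq>\<^sub>i B))"

text \<open>Sorts the rules by behaviour: \<open>down_settled\<close> survives shrinking
  \<open>H1\<close> and \<open>co H2\<close>, \<open>up_settled\<close> survives enlarging them.
  (b6) is kept apart because its negation feeds the classification.\<close>

lemma settled_ordered_iff:
  "settled_ordered H1 H2 \<longleftrightarrow>
     H1 \<subseteq>\<^sub>i code_graph (\<pi> 4) \<or> H2 \<subseteq>\<^sub>i code_graph (\<pi> 4) \<or>
     (\<exists>s t. s \<ge> 1 \<and> t \<ge> 1 \<and> H1 \<simeq> s \<cdot> Path 1 \<and> H2 \<simeq> Complete t) \<or>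
     down_settled H1 (co H2) \<or> H1 \<notin> class_S \<and> H2 \<notin> class_S \<or> co H1 \<notin> class_S \<and> co H2 \<notin> class_S \<or>
     up_settled H1 (co H2) \<or> code_graph (3 \<odot> \<pi> 1) \<subseteq>\<^sub>i H1 \<and> \<not> b6_free (co H2)"
  unfolding settled_ordered_def down_settled_def up_settled_def b6_free_def down_rules_def
    up_rules_def b6_codes_def
  by (simp only: named_graphs[THEN represents_sub] named_graphs[THEN represents_super] list.set
      bex_simps ball_simps case_prod_conv simp_thms de_Morgan_conj disj_ac)

lemma listed_iff:
  "listed H1 H2 \<longleftrightarrow> (\<exists>(a, b)\<in>set listed_codes. H1 \<simeq> code_graph a \<and> co H2 \<simeq> code_graph b)"
  unfolding listed_def listed_codes_def
  by (simp only: named_graphs[THEN represents_iso] list.map append.simps list.set bex_simps case_prod_conv simp_thms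
      conj_disj_distribL disj_assoc)

lemma down_settled_iso:
  "A \<simeq> A' \<Longrightarrow> B \<simeq> B' \<Longrightarrow> down_settled A B \<longleftrightarrow> down_settled A' B'"
  unfolding down_settled_def by (simp add: induced_sub_iso_left[of A A'] induced_sub_iso_left[of B B'])

lemma up_settled_iso:
  "A \<simeq> A' \<Longrightarrow> B \<simeq> B' \<Longrightarrow> up_settled A B \<longleftrightarrow> up_settled A' B'"
  unfolding up_settled_def by (simp add: induced_sub_iso_right[of A A'] induced_sub_iso_right[of B B'])

lemma b6_free_iso: "A \<simeq> A' \<Longrightarrow> b6_free A \<longleftrightarrow> b6_free A'"
  unfolding b6_free_def by (simp add: induced_sub_iso_right[of A A'])

lemma list_ex_zip_map:
  "list_ex (\<lambda>(x, y). x \<and> y) (zip (map f xs) (map g xs)) \<longleftrightarrow> (\<exists>x\<in>set xs. f x \<and> g x)"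
  by (induction xs) auto

lemma profiles_match_iff:
  "profiles_match (left_profile a) (right_profile b) \<longleftrightarrow>
     down_settled (code_graph a) (code_graph b) \<or> up_settled (code_graph a) (code_graph b)"
  unfolding profiles_match_def left_profile_def right_profile_def down_settled_def up_settled_def
  by (simp only: zip_append length_map list_ex_append list_ex_zip_map)
    (simp add: list_ex_iff code_sub_iff case_prod_unfold)

lemma Complete_eq: "Complete t = co (code_graph (replicate t None))"
  by (auto simp: Complete_def co_def code_graph_def)

lemma fin_graph_Complete [simp]: "fin_graph (Complete t)"
  by (simp add: Complete_eq)

lemma represents_isolated: "represents (replicate s None) (s \<cdot> Path 1)"
  using represents_copies[OF represents_Path, of s 1] by (simp only: isolated_code)

lemma edgeless_settled:
  assumes "fin_graph H1" "fin_graph H2" "s \<ge> 1" "t \<ge> 1"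
    "H1 \<simeq> code_graph (replicate s None)" "co H2 \<simeq> code_graph (replicate t None)"
  shows "settled_ordered H1 H2"
proof -
  have "H1 \<simeq> s \<cdot> Path 1" using assms(5) represents_iso[OF represents_isolated] by blast
  moreover have "H2 \<simeq> Complete t"
    using co_iso[OF _ _ assms(6)] assms(2) by (simp add: Complete_eq)
  ultimately show ?thesis unfolding settled_ordered_iff using assms by blast
qed

lemma P4_self_complementary: "co (code_graph (\<pi> 4)) \<simeq> code_graph (\<pi> 4)"
proof -
  have code: "\<pi> 4 = [None, Some 0, Some 1, Some 2]" by code_simp
  \<comment> \<open>The complement of the path 0-1-2-3 is the path 2-0-3-1; \<open>f\<close> sends
    2, 0, 3, 1 to 0, 1, 2, 3.\<close>
  define f where "f = (!) [1, 3, 0, 2 :: nat]"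
  have "embeds f (co (code_graph (\<pi> 4))) (code_graph (\<pi> 4))"
    unfolding embeds_def edges_co edges_code_graph code
    by (auto simp: f_def code_adj_def inj_on_def less_Suc_eq numeral_eq_Suc)
  then show ?thesis
    by (intro induced_sub_card_eq_imp_iso) (auto simp: induced_sub_iff_embeds)
qed

lemma co_sub_P4: "fin_graph H \<Longrightarrow> co H \<subseteq>\<^sub>i code_graph (\<pi> 4) \<longleftrightarrow> H \<subseteq>\<^sub>i code_graph (\<pi> 4)"
  using co_induced_sub_iff[of H "code_graph (\<pi> 4)"] induced_sub_iso_right[OF P4_self_complementary] by auto

section \<open>Pairs equivalent to a listed pair\<close>

text \<open>A complementation is undone by another one only on well-formed graphs, so
  \<open>fin_graph\<close> has to travel along the chain.\<close>

lemma pair_step_fin_sym: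
  assumes "pair_step x y" "fin_graph (fst x)" "fin_graph (snd x)"
  shows "fin_graph (fst y) \<and> fin_graph (snd y) \<and> pair_step y x"
  using assms
proof (induction rule: pair_step.induct)
  case (swap A B)
  then show ?case by (simp add: pair_step.swap)
next
  case (iso A' B' A B)
  then show ?case by (simp add: pair_step.iso graph_iso_sym)
next
  case (complement A B)
  then show ?case using pair_step.complement[of "co A" "co B"] by simp
next
  case (from_K3 B)
  then show ?case using fin_graph_disj_union[OF fin_graph_Path fin_graph_Path] by (simp add: pair_step.to_K3 del: One_nat_def)
next
  case (to_K3 B)
  then show ?case by (simp add: pair_step.from_K3 del: One_nat_def)
qed

definition orbit :: "ugraph \<Rightarrow> ugraph \<Rightarrow> bool" where
  "orbit H1 H2 \<longleftrightarrow> (\<exists>(a, b)\<in>set orbit_codes. H1 \<simeq> code_graph a \<and> co H2 \<simeq> code_graph b)"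

lemma orbit_codes_swap: "(a, b) \<in> set orbit_codes \<Longrightarrow> (b, a) \<in> set orbit_codes"
proof -
  have "(b, a) \<in> P \<union> prod.swap ` P" if "(a, b) \<in> P \<union> prod.swap ` P" for P
    using that by force
  then show "(a, b) \<in> set orbit_codes \<Longrightarrow> (b, a) \<in> set orbit_codes"
    unfolding orbit_codes_def Let_def set_append[of "_ @ _"] set_map[of prod.swap] .
qed

lemma orbit_complement:
  assumes "fin_graph H1" "orbit H1 H2" shows "orbit (co H2) (co H1)"
  using assms orbit_codes_swap unfolding orbit_def by fastforce

lemma orbit_iso:
  assumes "fin_graph A" "fin_graph B" "fin_graph A'" "fin_graph B'" "A \<simeq> A'" "B \<simeq> B'" "orbit A B"
  shows "orbit A' B'"
proof -
  obtain a b where ab: "(a, b) \<in> set orbit_codes" "A \<simeq> code_graph a" "co B \<simeq> code_graph b"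
    using assms(7) unfolding orbit_def by blast
  have "A' \<simeq> code_graph a" using ab(2) assms(5) graph_iso_sym graph_iso_trans by blast
  moreover have "co B' \<simeq> code_graph b"
    using ab(3) co_iso[OF assms(2,4,6)] graph_iso_sym graph_iso_trans by blast
  ultimately show ?thesis using ab(1) unfolding orbit_def by blast
qed

lemma orbitE:
  assumes "orbit H1 H2"
  obtains a b where "(a, b) \<in> set orbit_codes" "H1 \<simeq> code_graph a" "co H2 \<simeq> code_graph b"
    "code_graph (3 \<odot> \<pi> 1) \<subseteq>\<^sub>i H1" "code_graph (3 \<odot> \<pi> 1) \<subseteq>\<^sub>i co H2" "forest_like H1" "forest_like (co H2)"
proof -
  obtain a b where ab: "(a, b) \<in> set orbit_codes" "H1 \<simeq> code_graph a" "co H2 \<simeq> code_graph b"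
    using assms unfolding orbit_def by blast
  have "code_graph (3 \<odot> \<pi> 1) \<subseteq>\<^sub>i code_graph a" "code_graph (3 \<odot> \<pi> 1) \<subseteq>\<^sub>i code_graph b"
    using orbit_super_3P1 ab(1) orbit_codes_swap[OF ab(1)] unfolding code_sub_iff by blast+
  moreover have "forest_like H1" "forest_like (co H2)"
    using forest_like_code_graph forest_like_induced_sub graph_iso_imp_induced_sub ab(2,3) by blast+
  ultimately show ?thesis
    using that ab induced_sub_iso_right[OF ab(2)] induced_sub_iso_right[OF ab(3)] by blast
qed

text \<open>Such a complement contains a triangle, whereas first graphs here are forests. This
  decides on which side K3 or the complement of P1+P3 stands.\<close>

lemma not_orbit_co:
  assumes "fin_graph X" "code_graph (3 \<odot> \<pi> 1) \<subseteq>\<^sub>i X" shows "\<not> orbit (co X) B"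
proof
  assume "orbit (co X) B"
  then have "forest_like (co X)" by (rule orbitE)
  then show False using co_not_forest_like[OF _ assms(1)] assms(2) induced_sub_refl by blast
qed

lemma orbit_exchange_right:
  assumes "orbit B (co X)" "represents p X" "represents q Y"
    and "\<forall>(a, b)\<in>set orbit_codes. code_sub p b \<and> code_sub b p \<longrightarrow> (a, q) \<in> set orbit_codes"
  shows "orbit B (co Y)"
proof -
  obtain a b where ab: "(a, b) \<in> set orbit_codes" "B \<simeq> code_graph a" "co (co X) \<simeq> code_graph b"
    using assms(1) unfolding orbit_def by blast
  have "X \<simeq> code_graph b" "X \<simeq> code_graph p" using ab(3) assms(2) unfolding represents_def by simp_all
  then have "code_graph b \<simeq> code_graph p" using graph_iso_sym graph_iso_trans by blast
  then have "code_sub p b \<and> code_sub b p"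
    unfolding code_sub_iff[symmetric] using graph_iso_imp_induced_sub graph_iso_sym by blast
  then have "(a, q) \<in> set orbit_codes" using assms(4) ab(1) by blast
  then show ?thesis using ab(2) assms(3) unfolding orbit_def represents_def by auto
qed

lemma K3_eq: "Complete 3 = co (code_graph (3 \<odot> \<pi> 1))"
  by (simp only: Complete_eq isolated_code)

lemma code_sub_P1_P3: "code_sub (3 \<odot> \<pi> 1) (\<pi> 1 \<boxplus> \<pi> 3)"
  by code_simp

lemma orbit_step:
  assumes "pair_step x y" "fin_graph (fst x)" "fin_graph (snd x)"
    "orbit (fst x) (snd x) \<or> orbit (snd x) (fst x)"
  shows "orbit (fst y) (snd y) \<or> orbit (snd y) (fst y)"
  using assms
proof (induction rule: pair_step.induct)
  case (swap A B)
  then show ?case by auto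
next
  case (iso A' B' A B)
  then show ?case using orbit_iso[of A B A' B'] orbit_iso[of B A B' A'] by auto
next
  case (complement A B)
  then show ?case using orbit_complement[of A B] orbit_complement[of B A] by auto
next
  case (from_K3 B)
  have "\<not> orbit (Complete 3) B"
    unfolding K3_eq by (rule not_orbit_co) (simp_all only: fin_graph_code_graph induced_sub_refl)
  then have "orbit B (Complete 3)" using from_K3 by simp
  then have "orbit B (co (Path 1 \<oplus> Path 3))"
    unfolding K3_eq using orbit_exchange by (intro orbit_exchange_right[OF _ represents_code named_graphs(4)]) auto
  then show ?case by simp
next
  case (to_K3 B)
  have "code_graph (3 \<odot> \<pi> 1) \<subseteq>\<^sub>i Path 1 \<oplus> Path 3"
    unfolding represents_sub[OF named_graphs(4)] using code_sub_P1_P3 code_sub_iff by blast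
  then have "\<not> orbit (co (Path 1 \<oplus> Path 3)) B"
    using fin_graph_disj_union[OF fin_graph_Path fin_graph_Path] by (intro not_orbit_co)
  then have "orbit B (co (Path 1 \<oplus> Path 3))" using to_K3 by simp
  then have "orbit B (Complete 3)"
    unfolding K3_eq using orbit_exchange by (intro orbit_exchange_right[OF _ named_graphs(4) represents_code]) auto
  then show ?case by simp
qed

lemma orbit_steps:
  assumes "pair_step\<^sup>*\<^sup>* x y" "fin_graph (fst x)" "fin_graph (snd x)"
  shows "fin_graph (fst y) \<and> fin_graph (snd y) \<and>
    (orbit (fst x) (snd x) \<or> orbit (snd x) (fst x) \<longleftrightarrow> orbit (fst y) (snd y) \<or> orbit (snd y) (fst y))"
  using assms
proof (induction rule: rtranclp_induct)
  case base
  then show ?case by simp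
next
  case (step y z)
  then have fin: "fin_graph (fst y)" "fin_graph (snd y)" by auto
  then have z: "fin_graph (fst z)" "fin_graph (snd z)" "pair_step z y"
    using pair_step_fin_sym[OF step.hyps(2)] by auto
  show ?case
    using step.IH step.prems z orbit_step[OF step.hyps(2) fin] orbit_step[OF z(3) z(1,2)] by blast
qed

text \<open>A containment either way would place the complement of a graph with 3P1 inside a
  forest.\<close>

lemma orbit_incomparable:
  assumes "fin_graph H1" "fin_graph H2" "orbit H1 H2"
  shows "\<not> H1 \<subseteq>\<^sub>i H2" "\<not> H2 \<subseteq>\<^sub>i H1"
proof -
  have H: "code_graph (3 \<odot> \<pi> 1) \<subseteq>\<^sub>i H1" "code_graph (3 \<odot> \<pi> 1) \<subseteq>\<^sub>i co H2" "forest_like H1" "forest_like (co H2)"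
    using assms(3) by (auto elim: orbitE)
  show "\<not> H1 \<subseteq>\<^sub>i H2" using co_not_forest_like[OF H(4) assms(1)] H(1) co_mono[OF assms(1,2)] by blast
  show "\<not> H2 \<subseteq>\<^sub>i H1" using co_not_forest_like[OF H(3) fin_graph_co[OF assms(2)]] H(2) assms(2) by auto
qed

lemma orbit_Free_eq:
  assumes fin: "fin_graph A" "fin_graph B" "fin_graph C" "fin_graph D"
    and "orbit A B \<or> orbit B A" "Free A B = Free C D"
  shows "orbit C D \<or> orbit D C"
proof -
  have "\<not> A \<subseteq>\<^sub>i B" "\<not> B \<subseteq>\<^sub>i A" using orbit_incomparable fin assms(5) by blast+
  then have "(C \<simeq> A \<and> D \<simeq> B) \<or> (C \<simeq> B \<and> D \<simeq> A)" using Free_eq_incomparable fin assms(6) by blast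
  then show ?thesis using assms(5) orbit_iso fin graph_iso_sym by blast
qed

lemma code_graph_class_S:
  "r \<ge> 1 \<Longrightarrow> code_graph (\<pi> r) \<in> class_S"
  "1 \<le> i \<Longrightarrow> i \<le> j \<Longrightarrow> j \<le> k \<Longrightarrow> code_graph (\<sigma> i j k) \<in> class_S"
  "code_graph p \<in> class_S \<Longrightarrow> code_graph q \<in> class_S \<Longrightarrow> code_graph (p \<boxplus> q) \<in> class_S"
  "code_graph p \<in> class_S \<Longrightarrow> code_graph (s \<odot> p) \<in> class_S"
proof -
  have represented: "code_graph p \<in> class_S" if "represents p G" "G \<in> class_S" for p G
    using class_S_iso that unfolding represents_def by simp
  show "r \<ge> 1 \<Longrightarrow> code_graph (\<pi> r) \<in> class_S"
    by (rule represented[OF represents_Path class_S_Path])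
  show "code_graph (\<sigma> i j k) \<in> class_S" if "1 \<le> i" "i \<le> j" "j \<le> k"
    using that by (intro represented[OF represents_S_tree class_S_S_tree]) auto
  show "code_graph (p \<boxplus> q) \<in> class_S" if "code_graph p \<in> class_S" "code_graph q \<in> class_S"
    by (rule represented[OF represents_union[OF represents_code represents_code] class_S_disj_union[OF that]])
  show "code_graph (s \<odot> p) \<in> class_S" if "code_graph p \<in> class_S"
    by (rule represented[OF represents_copies[OF represents_code] class_S_copies[OF that]])
qed

lemma orbit_codes_class_S:
  assumes "(a, b) \<in> set orbit_codes" shows "code_graph a \<in> class_S"
proof -
  have "\<forall>(a, b)\<in>set listed_codes. code_graph a \<in> class_S \<and> code_graph b \<in> class_S"
    unfolding listed_codes_def
    by (simp only: list.map append.simps list.set ball_simps case_prod_conv simp_thms)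
      (intro conjI code_graph_class_S; simp)
  moreover have "code_graph (\<pi> 1 \<boxplus> \<pi> 3) \<in> class_S" by (intro code_graph_class_S; simp)
  ultimately show ?thesis using assms unfolding orbit_codes_def Let_def by auto
qed

lemma no_edge_in_isolated: "\<not> code_graph (\<pi> 2) \<subseteq>\<^sub>i code_graph (replicate s None)"
proof
  assume "code_graph (\<pi> 2) \<subseteq>\<^sub>i code_graph (replicate s None)"
  then obtain f where f: "embeds f (code_graph (\<pi> 2)) (code_graph (replicate s None))"
    unfolding induced_sub_iff_embeds by blast
  have "{0, 1} \<in> edges (code_graph (\<pi> 2))" by (simp add: edges_code_graph code_adj_def code_path_def)
  then have "{f 0, f 1} \<in> edges (code_graph (replicate s None))"
    using f unfolding embeds_def by (simp add: code_path_def)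
  then show False by (auto simp: edges_code_graph code_adj_def split: if_splits)
qed

lemma orbit_not_settled:
  assumes fin: "fin_graph H1" "fin_graph H2" and "orbit H1 H2"
  shows "\<not> settled H1 H2"
proof -
  from assms(3) obtain a b where ab: "(a, b) \<in> set orbit_codes" "H1 \<simeq> code_graph a" "co H2 \<simeq> code_graph b"
    and H: "code_graph (3 \<odot> \<pi> 1) \<subseteq>\<^sub>i H1" "code_graph (3 \<odot> \<pi> 1) \<subseteq>\<^sub>i co H2" "forest_like H1" "forest_like (co H2)"
    by (rule orbitE)
  have "\<not> code_graph a \<subseteq>\<^sub>i code_graph (\<pi> 4)" "\<not> code_graph b \<subseteq>\<^sub>i code_graph (\<pi> 4)"
    using orbit_not_sub_P4 ab(1) orbit_codes_swap[OF ab(1)] unfolding code_sub_iff by blast+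
  then have P4: "\<not> H1 \<subseteq>\<^sub>i code_graph (\<pi> 4)" "\<not> H2 \<subseteq>\<^sub>i code_graph (\<pi> 4)"
    using induced_sub_iso_left[OF ab(2)] induced_sub_iso_left[OF ab(3)] co_sub_P4[OF fin(2)] by blast+
  have S: "H1 \<in> class_S" "co H2 \<in> class_S"
    using class_S_iso[OF orbit_codes_class_S _ graph_iso_sym] ab orbit_codes_swap[OF ab(1)] fin fin_graph_co by blast+
  have isolated: "X \<simeq> code_graph (replicate t None)" if "co X \<simeq> Complete t" "fin_graph X" for X t
    using co_iso[OF _ _ that(1)] that(2) by (simp add: Complete_eq)
  have co_H1: "\<not> co H1 \<subseteq>\<^sub>i code_graph p" for p
    using co_not_forest_like[OF forest_like_code_graph fin(1)] H(1) by blast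
  have "\<not> settled_ordered H1 H2"
  proof -
    have "\<not> down_settled H1 (co H2) \<and> \<not> up_settled H1 (co H2)"
      using orbit_profiles ab(1) unfolding profiles_match_iff down_settled_iso[OF ab(2,3)] up_settled_iso[OF ab(2,3)] by blast
    moreover have "b \<in> set (remdups (map snd orbit_codes))" using ab(1) by force
    then have "b6_free (co H2)"
      using orbit_b6_free unfolding b6_free_iso[OF ab(3)] unfolding b6_free_def code_sub_iff
      by blast
    \<comment> \<open>Rule (a2) would make both \<open>H1\<close> and \<open>co H2\<close>
      edgeless.\<close>
    moreover have False if "H1 \<simeq> s \<cdot> Path 1" "H2 \<simeq> Complete t" for s t
    proof -
      have "H1 \<simeq> code_graph (replicate s None)" using that(1) represents_iso[OF represents_isolated] by blast
      moreover have "co H2 \<simeq> code_graph (replicate t None)" using isolated[of "co H2" t] that(2) fin by simp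
      ultimately have "\<not> code_graph (\<pi> 2) \<subseteq>\<^sub>i H1" "\<not> code_graph (\<pi> 2) \<subseteq>\<^sub>i co H2"
        using no_edge_in_isolated induced_sub_iso_right by blast+
      then show False
        using orbit_has_edge ab(1) unfolding induced_sub_iso_right[OF ab(2)] induced_sub_iso_right[OF ab(3)] code_sub_iff
        by blast
    qed
    ultimately show ?thesis unfolding settled_ordered_iff using P4 S by blast
  qed
  moreover have "\<not> settled_ordered H2 H1"
  proof -
    have no: "\<not> code_graph X \<subseteq>\<^sub>i H2" if "code_sub (3 \<odot> \<pi> 1) X \<or> code_sub (2 \<odot> \<pi> 2) X" for X
      using co_not_forest_like[OF H(4) fin(2)] induced_sub_trans induced_sub_refl that
      unfolding code_sub_iff[symmetric] by blast
    have "\<not> down_settled H2 (co H1)" unfolding down_settled_def using co_H1 by blast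
    moreover have "\<not> up_settled H2 (co H1)" unfolding up_settled_def using up_rules_super no by fastforce
    moreover have "\<not> code_graph (3 \<odot> \<pi> 1) \<subseteq>\<^sub>i H2"
      using co_not_forest_like[OF H(4) fin(2)] induced_sub_refl by blast
    moreover have False if "H1 \<simeq> Complete t" for t
    proof -
      have "co H1 \<simeq> code_graph (replicate t None)" using isolated[of "co H1" t] that fin(1) by simp
      then show False using co_H1 graph_iso_imp_induced_sub by blast
    qed
    ultimately show ?thesis unfolding settled_ordered_iff using P4 S fin by auto
  qed
  ultimately show ?thesis unfolding settled_def by blast
qed

section \<open>Pairs not equivalent to a settled pair\<close>

text \<open>Quantifies over everything reachable, so that a rule may be applied after any
  operations, in particular after exchanging the two coordinates.\<close>

definition unsettled :: "ugraph \<Rightarrow> ugraph \<Rightarrow> bool" where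
  "unsettled H1 H2 \<longleftrightarrow> (\<forall>H3 H4. pair_step\<^sup>*\<^sup>* (H1, H2) (H3, H4) \<longrightarrow>
     fin_graph H3 \<longrightarrow> fin_graph H4 \<longrightarrow> \<not> settled H3 H4)"

definition reaches_listed :: "ugraph \<Rightarrow> ugraph \<Rightarrow> bool" where
  "reaches_listed H1 H2 \<longleftrightarrow> (\<exists>H3 H4. pair_step\<^sup>*\<^sup>* (H1, H2) (H3, H4) \<and>
     fin_graph H3 \<and> fin_graph H4 \<and> listed H3 H4)"

lemma unsettled_step: "pair_step\<^sup>*\<^sup>* (H1, H2) (H3, H4) \<Longrightarrow> unsettled H1 H2 \<Longrightarrow> unsettled H3 H4"
  unfolding unsettled_def by (meson rtranclp_trans)

lemma reaches_listed_step:
  "pair_step\<^sup>*\<^sup>* (H1, H2) (H3, H4) \<Longrightarrow> reaches_listed H3 H4 \<Longrightarrow> reaches_listed H1 H2"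
  unfolding reaches_listed_def by (meson rtranclp_trans)

text \<open>In the coordinates \<open>H1\<close> and \<open>co H2\<close> this exchanges the two
  entries.\<close>

lemma flip_steps: "pair_step\<^sup>*\<^sup>* (H1, H2) (co H2, co H1)"
  by (meson converse_rtranclp_into_rtranclp pair_step.complement pair_step.swap rtranclp.rtrancl_refl)

lemma unsettledD:
  assumes "fin_graph H1" "fin_graph H2" "unsettled H1 H2" shows "\<not> settled_ordered H1 H2"
  using assms unfolding unsettled_def settled_def by blast

text \<open>If \<open>co H2\<close> contains a graph of (b6), that rule keeps 3P1 out of
  \<open>H1\<close>. Then \<open>H1\<close> is catalogued and, not lying in P4, contains 2P2. Every
  (b6) graph contains 4P1 or 2P2, so (b3) settles the pair after all.\<close>

lemma unsettled_b6_free: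
  assumes "fin_graph H1" "fin_graph H2" "H1 \<in> class_S" "unsettled H1 H2"
  shows "b6_free (co H2)"
proof (rule ccontr)
  assume "\<not> b6_free (co H2)"
  then obtain Y where Y: "Y \<in> set b6_codes" "code_graph Y \<subseteq>\<^sub>i co H2"
    unfolding b6_free_def by blast
  have unset: "\<not> H1 \<subseteq>\<^sub>i code_graph (\<pi> 4)" "\<not> code_graph (3 \<odot> \<pi> 1) \<subseteq>\<^sub>i H1" "\<not> up_settled H1 (co H2)"
    using unsettledD[OF assms(1,2,4)] \<open>\<not> b6_free (co H2)\<close> unfolding settled_ordered_iff by blast+
  obtain p where p: "catalogued p" "H1 \<simeq> code_graph p"
    using class_S_catalogued[OF assms(3) b6_free_if_no_3P1[OF unset(2)]] by blast
  have 1: "code_graph (2 \<odot> \<pi> 2) \<subseteq>\<^sub>i H1"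
    using catalogued_small_or_super[OF p(1)] unset
    unfolding induced_sub_iso_left[OF p(2)] induced_sub_iso_right[OF p(2)] by blast
  have "code_graph (4 \<odot> \<pi> 1) \<subseteq>\<^sub>i co H2 \<or> code_graph (2 \<odot> \<pi> 2) \<subseteq>\<^sub>i co H2"
    using b6_codes_super Y induced_sub_trans unfolding code_sub_iff[symmetric] by blast
  then have "up_settled H1 (co H2)" unfolding up_settled_def up_rules_def using 1 by auto
  then show False using unset(3) by blast
qed

text \<open>The operation on K3 concerns the complement, so it is placed between two
  complementations; the second one restores \<open>H2\<close>.\<close>

lemma replace_P1_P3:
  assumes "fin_graph H1" "fin_graph H2" "H1 \<simeq> code_graph (\<pi> 1 \<boxplus> \<pi> 3)"
  shows "pair_step\<^sup>*\<^sup>* (H1, H2) (code_graph (3 \<odot> \<pi> 1), H2)"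
proof -
  let ?P = "Path 1 \<oplus> Path 3"
  have fin: "fin_graph ?P" by (intro fin_graph_disj_union fin_graph_Path)
  have 1: "pair_step (H1, H2) (?P, H2)"
    using assms fin represents_iso[OF named_graphs(4)] graph_iso_refl by (intro pair_step.iso) blast+
  have 2: "pair_step (?P, H2) (co ?P, co H2)" by (rule pair_step.complement)
  have 3: "pair_step (co ?P, co H2) (Complete 3, co H2)" by (rule pair_step.to_K3)
  have 4: "pair_step (Complete 3, co H2) (code_graph (3 \<odot> \<pi> 1), H2)"
    using pair_step.complement[of "Complete 3" "co H2"] assms(2) unfolding K3_eq by (simp del: One_nat_def)
  show ?thesis
    using 1 2 3 4 by (meson converse_rtranclp_into_rtranclp rtranclp.rtrancl_refl)
qed

lemma large_codes_nonempty: "[] \<notin> set large_codes"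
  by code_simp

lemma large_pair_reaches_listed:
  assumes fin: "fin_graph H1" "fin_graph H2" and uns: "unsettled H1 H2"
    and a: "H1 \<simeq> code_graph a" "a \<in> set large_codes \<or> (\<exists>s\<ge>5. a = replicate s None)"
    and b: "co H2 \<simeq> code_graph b" "b \<in> set large_codes \<or> (\<exists>s\<ge>5. b = replicate s None)"
  shows "reaches_listed H1 H2"
proof -
  have n1: "\<not> settled_ordered H1 H2" using unsettledD fin uns by blast
  \<comment> \<open>The flipped pair excludes the rules with the two codes exchanged.\<close>
  have n2: "\<not> settled_ordered (co H2) (co H1)"
    using unsettledD[OF _ _ unsettled_step[OF flip_steps uns]] fin by simp
  have no: "\<not> down_settled (code_graph a) (code_graph b)" "\<not> up_settled (code_graph a) (code_graph b)"
    "\<not> down_settled (code_graph b) (code_graph a)" "\<not> up_settled (code_graph b) (code_graph a)"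
    using n1 n2 fin unfolding settled_ordered_iff down_settled_iso[OF a(1) b(1), symmetric] up_settled_iso[OF a(1) b(1), symmetric]
      down_settled_iso[OF b(1) a(1), symmetric] up_settled_iso[OF b(1) a(1), symmetric] by auto
  \<comment> \<open>Rule (a2) asks for positive sizes.\<close>
  have nonempty: "a \<noteq> []" "b \<noteq> []"
    using a(2) b(2) large_codes_nonempty by auto
  have edge: "\<not> (edgeless_code a \<and> edgeless_code b)"
  proof
    assume "edgeless_code a \<and> edgeless_code b"
    then have "H1 \<simeq> code_graph (replicate (length a) None)" "co H2 \<simeq> code_graph (replicate (length b) None)"
      using a b by (simp_all add: edgeless_code_iff)
    then show False using n1 edgeless_settled[OF fin, of "length a" "length b"] nonempty
      by (simp add: Suc_le_eq)
  qed
  have five: False if "p = replicate s None" "s \<ge> 5" "q \<in> set large_codes" "\<not> edgeless_code q"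
    "\<not> up_settled (code_graph q) (code_graph p)" for p q s
  proof -
    have sub: "code_graph (5 \<odot> \<pi> 1) \<subseteq>\<^sub>i code_graph p" using large_edgeless_super that by simp
    have "\<exists>(Xs, Ys)\<in>set up_rules. (\<exists>X\<in>set Xs. code_sub X q) \<and> (\<exists>Y\<in>set Ys. code_sub Y (5 \<odot> \<pi> 1))"
      using five_isolated_pairs that(3,4) by blast
    then have "up_settled (code_graph q) (code_graph p)"
      unfolding up_settled_def code_sub_iff[symmetric] using induced_sub_trans[OF _ sub] by fast
    then show False using that(5) by blast
  qed
  have edgeless_replicate: "edgeless_code (replicate s None)" for s by (simp add: edgeless_code_iff)
  have ab: "a \<in> set large_codes" "b \<in> set large_codes"
    using a(2) b(2) edge five no edgeless_replicate by metis+
  have "profiled a \<in> set (map profiled large_codes)" "profiled b \<in> set (map profiled large_codes)"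
    using ab by auto
  from bspec[OF large_pairs this(1)] this(2)
  have "profiles_match (left_profile a) (right_profile b) \<or> profiles_match (left_profile b) (right_profile a) \<or>
      edgeless_code a \<and> edgeless_code b \<or> (a, b) \<in> set listed_codes \<or> (b, a) \<in> set listed_codes"
    unfolding profiled_def case_prod_conv by (auto simp del: set_map)
  then consider "(a, b) \<in> set listed_codes" | "(b, a) \<in> set listed_codes"
    using no edge unfolding profiles_match_iff by blast
  then show ?thesis
  proof cases
    case 1
    then have "listed H1 H2" unfolding listed_iff using a(1) b(1) by blast
    then show ?thesis unfolding reaches_listed_def using fin by blast
  next
    case 2
    then have "listed (co H2) (co H1)" unfolding listed_iff using a(1) b(1) fin by fastforce
    then show ?thesis unfolding reaches_listed_def using fin flip_steps fin_graph_co by blast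
  qed
qed

lemma normalise_left:
  assumes fin: "fin_graph H1" "fin_graph H2" and "H1 \<in> class_S" "b6_free H1" "\<not> H1 \<subseteq>\<^sub>i code_graph (\<pi> 4)"
  obtains H a where "pair_step\<^sup>*\<^sup>* (H1, H2) (H, H2)" "fin_graph H" "H \<simeq> code_graph a"
    "a \<in> set large_codes \<or> (\<exists>s\<ge>5. a = replicate s None)"
proof -
  obtain p where p: "catalogued p" "H1 \<simeq> code_graph p"
    using class_S_catalogued assms(3,4) by blast
  have "p \<notin> set small_codes"
    using small_codes_sub assms(5) unfolding induced_sub_iso_left[OF p(2)] code_sub_iff by blast
  then consider "p = \<pi> 1 \<boxplus> \<pi> 3" | "p \<in> set large_codes \<or> (\<exists>s\<ge>5. p = replicate s None)"
    using p(1) unfolding catalogued_def catalogue_def by auto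
  then show thesis
  proof cases
    case 1
    have "3 \<odot> \<pi> 1 \<in> set large_codes" by (simp add: large_codes_def)
    then show thesis
      using that[of "code_graph (3 \<odot> \<pi> 1)" "3 \<odot> \<pi> 1"] replace_P1_P3[OF fin] p(2) 1 graph_iso_refl by simp
  next
    case 2
    then show thesis using that[of H1 p] p(2) fin by simp
  qed
qed

lemma class_S_pair_reaches_listed:
  assumes fin: "fin_graph H1" "fin_graph H2" and uns: "unsettled H1 H2"
    and S: "H1 \<in> class_S" "co H2 \<in> class_S"
  shows "reaches_listed H1 H2"
proof -
  have n: "\<not> H1 \<subseteq>\<^sub>i code_graph (\<pi> 4)" "\<not> co H2 \<subseteq>\<^sub>i code_graph (\<pi> 4)"
    using unsettledD[OF fin uns] co_sub_P4[OF fin(2)] unfolding settled_ordered_iff by blast+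
  have free2: "b6_free (co H2)" using unsettled_b6_free[OF fin S(1) uns] .
  have free1: "b6_free H1"
    using unsettled_b6_free[OF _ _ S(2) unsettled_step[OF flip_steps uns]] fin by simp
  obtain H3 a where a: "pair_step\<^sup>*\<^sup>* (H1, H2) (H3, H2)" "fin_graph H3" "H3 \<simeq> code_graph a"
    "a \<in> set large_codes \<or> (\<exists>s\<ge>5. a = replicate s None)"
    using normalise_left[OF fin S(1) free1 n(1)] .
  \<comment> \<open>After a flip, the same normalisation acts on what was the second graph.\<close>
  obtain H4 b where b: "pair_step\<^sup>*\<^sup>* (co H2, co H3) (H4, co H3)" "fin_graph H4" "H4 \<simeq> code_graph b"
    "b \<in> set large_codes \<or> (\<exists>s\<ge>5. b = replicate s None)"
    using normalise_left[OF fin_graph_co[OF fin(2)] fin_graph_co[OF a(2)] S(2) free2 n(2)] .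
  have steps: "pair_step\<^sup>*\<^sup>* (H1, H2) (H4, co H3)"
    using a(1) flip_steps b(1) by (meson rtranclp_trans)
  have "co (co H3) \<simeq> code_graph a" using a(2,3) by simp
  then have "reaches_listed H4 (co H3)"
    using large_pair_reaches_listed[OF b(2) fin_graph_co[OF a(2)] unsettled_step[OF steps uns] b(3,4)] a(4) by blast
  then show ?thesis using reaches_listed_step[OF steps] by blast
qed

lemma unsettled_reaches_listed:
  assumes fin: "fin_graph H1" "fin_graph H2" and uns: "unsettled H1 H2"
  shows "reaches_listed H1 H2"
proof -
  have n: "\<not> H1 \<subseteq>\<^sub>i code_graph (\<pi> 4)" "\<not> H2 \<subseteq>\<^sub>i code_graph (\<pi> 4)"
    "H1 \<in> class_S \<or> H2 \<in> class_S" "co H1 \<in> class_S \<or> co H2 \<in> class_S"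
    using unsettledD[OF fin uns] unfolding settled_ordered_iff by blast+
  have "\<not> (H1 \<in> class_S \<and> co H1 \<in> class_S)" "\<not> (H2 \<in> class_S \<and> co H2 \<in> class_S)"
    using n(1,2) class_S_and_co by blast+
  then consider "H1 \<in> class_S" "co H2 \<in> class_S" | "H2 \<in> class_S" "co H1 \<in> class_S"
    using n(3,4) by blast
  then show ?thesis
  proof cases
    case 1
    then show ?thesis using class_S_pair_reaches_listed[OF fin uns] by blast
  next
    case 2
    have step: "pair_step\<^sup>*\<^sup>* (H1, H2) (H2, H1)" by (simp add: pair_step.swap r_into_rtranclp)
    then show ?thesis
      using class_S_pair_reaches_listed[OF fin(2,1) unsettled_step[OF step uns] 2] reaches_listed_step by blast
  qed
qed

section \<open>From pairs of graphs to classes\<close>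

lemma listed_orbit: "listed H1 H2 \<Longrightarrow> orbit H1 H2"
  unfolding listed_iff orbit_def orbit_codes_def Let_def by auto

theorem theorem8:
  fixes \<G> :: "ugraph set"
  assumes "\<exists>H1 H2. fin_graph H1 \<and> fin_graph H2 \<and> \<G> = Free H1 H2"
  shows "(\<not> (\<exists>H1 H2. fin_graph H1 \<and> fin_graph H2 \<and> settled H1 H2 \<and> class_equiv \<G> (Free H1 H2)))
     \<longleftrightarrow> (\<exists>H1 H2. fin_graph H1 \<and> fin_graph H2 \<and> listed H1 H2 \<and> class_equiv \<G> (Free H1 H2))"
proof
  assume no: "\<not> (\<exists>H1 H2. fin_graph H1 \<and> fin_graph H2 \<and> settled H1 H2 \<and> class_equiv \<G> (Free H1 H2))"
  obtain H1 H2 where H: "fin_graph H1" "fin_graph H2" "\<G> = Free H1 H2" using assms by blast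
  have equiv: "class_equiv \<G> (Free H3 H4)"
    if "pair_step\<^sup>*\<^sup>* (H1, H2) (H3, H4)" "fin_graph H3" "fin_graph H4" for H3 H4
    using that H unfolding class_equiv_def by blast
  then have "unsettled H1 H2" using no unfolding unsettled_def by blast
  then have "reaches_listed H1 H2" using unsettled_reaches_listed H by blast
  then show "\<exists>H1 H2. fin_graph H1 \<and> fin_graph H2 \<and> listed H1 H2 \<and> class_equiv \<G> (Free H1 H2)"
    using equiv unfolding reaches_listed_def by blast
next
  let ?orbit = "\<lambda>A B. orbit A B \<or> orbit B A"
  \<comment> \<open>The given pair, the two ends of the chain and the pair defining the class may
    all differ: equal classes are handled by \<open>orbit_Free_eq\<close>, the chain by
    \<open>orbit_steps\<close>.\<close>
  have transfer: "\<exists>A B. fin_graph A \<and> fin_graph B \<and> \<G> = Free A B \<and> (?orbit L1 L2 \<longleftrightarrow> ?orbit A B)"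
    if "fin_graph L1" "fin_graph L2" and equiv: "class_equiv \<G> (Free L1 L2)" for L1 L2
  proof -
    obtain A B C D where fin: "fin_graph A" "fin_graph B" "fin_graph C" "fin_graph D"
      and eq: "\<G> = Free A B" "Free L1 L2 = Free C D" and steps: "pair_step\<^sup>*\<^sup>* (A, B) (C, D)"
      using equiv unfolding class_equiv_def by blast
    have "?orbit L1 L2 \<longleftrightarrow> ?orbit C D"
      using orbit_Free_eq[OF that(1,2) fin(3,4) _ eq(2)] orbit_Free_eq[OF fin(3,4) that(1,2) _ eq(2)[symmetric]]
      by blast
    moreover have "?orbit A B \<longleftrightarrow> ?orbit C D" using orbit_steps[OF steps] fin by simp
    ultimately show ?thesis using fin eq(1) by blast
  qed
  assume "\<exists>H1 H2. fin_graph H1 \<and> fin_graph H2 \<and> listed H1 H2 \<and> class_equiv \<G> (Free H1 H2)"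
  then obtain L1 L2 where L: "fin_graph L1" "fin_graph L2" "listed L1 L2" "class_equiv \<G> (Free L1 L2)"
    by blast
  then obtain A B where AB: "fin_graph A" "fin_graph B" "\<G> = Free A B" "?orbit A B"
    using transfer[OF L(1,2,4)] listed_orbit[OF L(3)] by blast
  show "\<not> (\<exists>H1 H2. fin_graph H1 \<and> fin_graph H2 \<and> settled H1 H2 \<and> class_equiv \<G> (Free H1 H2))"
  proof
    assume "\<exists>H1 H2. fin_graph H1 \<and> fin_graph H2 \<and> settled H1 H2 \<and> class_equiv \<G> (Free H1 H2)"
    then obtain S1 S2 where S: "fin_graph S1" "fin_graph S2" "settled S1 S2" "class_equiv \<G> (Free S1 S2)"
      by blast
    obtain C D where CD: "fin_graph C" "fin_graph D" "\<G> = Free C D" "?orbit S1 S2 \<longleftrightarrow> ?orbit C D"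
      using transfer[OF S(1,2,4)] by blast
    \<comment> \<open>The two equivalences may represent the class by different pairs, and equality
      of the classes links them.\<close>
    have "?orbit C D" using orbit_Free_eq[OF AB(1,2) CD(1,2) AB(4)] AB(3) CD(3) by simp
    then have "?orbit S1 S2" using CD(4) by blast
    then have "\<not> settled S1 S2 \<or> \<not> settled S2 S1" using orbit_not_settled S(1,2) by blast
    then show False using S(3) unfolding settled_def by blast
  qed
qed

end
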